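(* Feedback does not increase the capacity of a strongly connected finite-state channel when the state of the channel is known both at the encoder and at the decoder: the capacity when the encoder's feedback consists of the past states and the past outputs equals the capacity when it consists of the past states only. Furthermore, the capacity of the channel under this setting is given by $$C=\lim_{N\to\infty}\frac1N\max_{\{Q(x_i|s_{i-1})\}_{i=1}^N}\sum_{i=1}^N I(Y_i,S_i;X_i|S_{i-1}).$$
   Context: Finite-state channel (FSC): finite input, output and state alphabets $\mathcal X,\mathcal Y,\mathcal S$ and a time-invariant kernel $P(y_i,s_i|x_i,s_{i-1})$ with $P(y_i,s_i|x^i,s^{i-1},y^{i-1})=P(y_i,s_i|x_i,s_{i-1})$; $S_0$ is the initial state, with a given distribution $P(s_0)$. The FSC is strongly connected if there exist an input distribution $\{Q(x_t|s_{t-1})\}_{t\ge1}$ and an integer $T$ such that $\Pr\{S_t=s\text{ for some }1\le t\le T\mid S_0=s'\}>0$ for all $s',s\in\mathcal S$. State known at encoder and decoder: the decoder observes $(y_i,s_i)$ at each time $i$ (as well as $s_0$), and the encoder at time $i$ knows the past states $s_0,\dots,s_{i-1}$. Without (output) feedback the channel input is $x_i=x_i(m,s_0,\dots,s_{i-1})$; with feedback it is $x_i=x_i(m,s_0,\dots,s_{i-1},y^{i-1})$. A rate $R$ is achievable if there are codes of block length $N$ with $\lceil 2^{NR}\rceil$ messages whose maximal error probability over messages tends to $0$ as $N\to\infty$ for all initial states; capacity is the supremum of achievable rates. In the formula, the maximum is over all sequences of conditional probability mass functions $Q(x_i|s_{i-1})$, $i=1,\dots,N$, and the mutual informations are computed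 under the law $P(s_0)\prod_{i=1}^N Q(x_i|s_{i-1})P(y_i,s_i|x_i,s_{i-1})$. *)

theory Defs
  imports "HOL-Probability.Probability"
begin

type_synonym ('x, 'y, 's) kernel = "'x \<Rightarrow> 's \<Rightarrow> ('y \<times> 's) pmf"

text \<open>
  A trajectory \<open>(s\<^sub>0, [(x\<^sub>1, y\<^sub>1, s\<^sub>1), \<dots>, (x\<^sub>n, y\<^sub>n, s\<^sub>n)])\<close>. Inputs and outputs are indexed from \<open>1\<close>,
  states from \<open>0\<close>; the accessors are meaningful only for indices up to \<open>n\<close>.
\<close>
type_synonym ('x, 'y, 's) traj = "'s \<times> ('x \<times> 'y \<times> 's) list"

definition traj_states :: "('x, 'y, 's) traj \<Rightarrow> 's list" where
  "traj_states h = fst h # map (\<lambda>(x, y, s). s) (snd h)"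

definition traj_outputs :: "('x, 'y, 's) traj \<Rightarrow> 'y list" where
  "traj_outputs h = map (\<lambda>(x, y, s). y) (snd h)"

definition traj_inputs :: "('x, 'y, 's) traj \<Rightarrow> 'x list" where
  "traj_inputs h = map (\<lambda>(x, y, s). x) (snd h)"

definition state_at :: "nat \<Rightarrow> ('x, 'y, 's) traj \<Rightarrow> 's" where
  "state_at i h = traj_states h ! i"

definition output_at :: "nat \<Rightarrow> ('x, 'y, 's) traj \<Rightarrow> 'y" where
  "output_at i h = traj_outputs h ! (i - 1)"

definition input_at :: "nat \<Rightarrow> ('x, 'y, 's) traj \<Rightarrow> 'x" where
  "input_at i h = traj_inputs h ! (i - 1)"

text \<open>
  The law of the first \<open>n\<close> channel uses when the initial state is drawn from \<open>p0\<close> and each input is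
  drawn from \<open>\<pi> h\<close>, where \<open>h\<close> is the trajectory so far. Given the past and \<open>x\<^sub>i\<close>, the pair
  \<open>(y\<^sub>i, s\<^sub>i)\<close> depends only on \<open>x\<^sub>i\<close> and \<open>s\<^sub>i\<^sub>-\<^sub>1\<close>, through the time-invariant kernel \<open>W\<close>.
\<close>
primrec fsc_law ::
  "('x, 'y, 's) kernel \<Rightarrow> 's pmf \<Rightarrow> (('x, 'y, 's) traj \<Rightarrow> 'x pmf) \<Rightarrow> nat \<Rightarrow> ('x, 'y, 's) traj pmf"
where
  "fsc_law W p0 \<pi> 0 = map_pmf (\<lambda>s. (s, [])) p0"
| "fsc_law W p0 \<pi> (Suc n) =
     bind_pmf (fsc_law W p0 \<pi> n) (\<lambda>h.
     bind_pmf (\<pi> h) (\<lambda>x.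
     map_pmf (\<lambda>(y, s). (fst h, snd h @ [(x, y, s)])) (W x (last (traj_states h)))))"

text \<open>
  \<open>Q i s\<close> is the conditional law \<open>Q(x\<^sub>i | s\<^sub>i\<^sub>-\<^sub>1 = s)\<close>. A trajectory with \<open>i\<close> states
  \<open>s\<^sub>0, \<dots>, s\<^sub>i\<^sub>-\<^sub>1\<close> is followed by the \<open>i\<close>-th input; \<open>Q 0\<close> is never used.
\<close>
definition markov_rule :: "(nat \<Rightarrow> 's \<Rightarrow> 'x pmf) \<Rightarrow> ('x, 'y, 's) traj \<Rightarrow> 'x pmf" where
  "markov_rule Q h = Q (length (traj_states h)) (last (traj_states h))"

definition strongly_connected_fsc :: "('x, 'y, 's) kernel \<Rightarrow> bool" where
  "strongly_connected_fsc W \<longleftrightarrow>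
     (\<exists>Q T. \<forall>s' s.
        measure_pmf.prob (fsc_law W (return_pmf s') (markov_rule Q) T)
          {h. \<exists>t\<in>{1..T}. state_at t h = s} > 0)"


subsection \<open>Codes and operational capacity\<close>

text \<open>
  Messages are \<open>0, \<dots>, M - 1\<close>. A feedback encoder computes \<open>x\<^sub>i\<close> from the message, the list
  \<open>[s\<^sub>0, \<dots>, s\<^sub>i\<^sub>-\<^sub>1]\<close> and the list \<open>[y\<^sub>1, \<dots>, y\<^sub>i\<^sub>-\<^sub>1]\<close>; without output feedback the last argument
  is absent. After the block the decoder has \<open>[s\<^sub>0, \<dots>, s\<^sub>N]\<close> and \<open>[y\<^sub>1, \<dots>, y\<^sub>N]\<close>.
\<close>
type_synonym ('x, 'y, 's) fb_encoder = "nat \<Rightarrow> 's list \<Rightarrow> 'y list \<Rightarrow> 'x"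
type_synonym ('x, 's) encoder = "nat \<Rightarrow> 's list \<Rightarrow> 'x"
type_synonym ('y, 's) decoder = "'s list \<Rightarrow> 'y list \<Rightarrow> nat"

definition error_prob ::
  "('x, 'y, 's) kernel \<Rightarrow> nat \<Rightarrow> ('x, 'y, 's) fb_encoder \<Rightarrow> ('y, 's) decoder \<Rightarrow> 's \<Rightarrow> nat \<Rightarrow> real"
where
  "error_prob W N e d s0 m =
     measure_pmf.prob
       (fsc_law W (return_pmf s0) (\<lambda>h. return_pmf (e m (traj_states h) (traj_outputs h))) N)
       {h. d (traj_states h) (traj_outputs h) \<noteq> m}"

definition num_messages :: "nat \<Rightarrow> real \<Rightarrow> nat" where
  "num_messages N R = nat \<lceil>2 powr (real N * R)\<rceil>"

definition max_error_prob ::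
  "('x, 'y, 's) kernel \<Rightarrow> real \<Rightarrow> nat \<Rightarrow> ('x, 'y, 's) fb_encoder \<Rightarrow> ('y, 's) decoder \<Rightarrow> 's \<Rightarrow> real"
where
  "max_error_prob W R N e d s0 = (MAX m\<in>{..<num_messages N R}. error_prob W N e d s0 m)"

definition achievable_feedback :: "('x, 'y, 's) kernel \<Rightarrow> real \<Rightarrow> bool" where
  "achievable_feedback W R \<longleftrightarrow>
     (\<exists>(e :: nat \<Rightarrow> ('x, 'y, 's) fb_encoder) (d :: nat \<Rightarrow> ('y, 's) decoder).
        \<forall>s0. (\<lambda>N. max_error_prob W R N (e N) (d N) s0) \<longlonglongrightarrow> 0)"

definition achievable :: "('x, 'y, 's) kernel \<Rightarrow> real \<Rightarrow> bool" where
  "achievable W R \<longleftrightarrow>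
     (\<exists>(e :: nat \<Rightarrow> ('x, 's) encoder) (d :: nat \<Rightarrow> ('y, 's) decoder).
        \<forall>s0. (\<lambda>N. max_error_prob W R N (\<lambda>m ss ys. e N m ss) (d N) s0) \<longlonglongrightarrow> 0)"

definition capacity_feedback :: "('x, 'y, 's) kernel \<Rightarrow> ereal" where
  "capacity_feedback W = (SUP R\<in>{R. 0 \<le> R \<and> achievable_feedback W R}. ereal R)"

definition capacity :: "('x, 'y, 's) kernel \<Rightarrow> ereal" where
  "capacity W = (SUP R\<in>{R. 0 \<le> R \<and> achievable W R}. ereal R)"


subsection \<open>The information expression\<close>

text \<open>\<open>I(Y\<^sub>i, S\<^sub>i; X\<^sub>i | S\<^sub>i\<^sub>-\<^sub>1)\<close> in bits, for \<open>1 \<le> i \<le> N\<close>.\<close>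
definition step_information ::
  "('x, 'y, 's) kernel \<Rightarrow> 's pmf \<Rightarrow> (nat \<Rightarrow> 's \<Rightarrow> 'x pmf) \<Rightarrow> nat \<Rightarrow> nat \<Rightarrow> real"
where
  "step_information W p0 Q N i =
     prob_space.conditional_mutual_information
       (measure_pmf (fsc_law W p0 (markov_rule Q) N)) 2
       (count_space UNIV) (count_space UNIV) (count_space UNIV)
       (\<lambda>h. (output_at i h, state_at i h)) (input_at i) (state_at (i - 1))"

definition block_information ::
  "('x, 'y, 's) kernel \<Rightarrow> 's pmf \<Rightarrow> nat \<Rightarrow> (nat \<Rightarrow> 's \<Rightarrow> 'x pmf) \<Rightarrow> real"
where
  "block_information W p0 N Q = (\<Sum>i=1..N. step_information W p0 Q N i)"

end

theory Submission
  imports Defs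
begin

text \<open>
  Choosing the laws \<open>Q(x\<^sub>i | s\<^sub>i\<^sub>-\<^sub>1)\<close> is a finite Markov decision problem whose one-step reward is the mutual
  information of the channel in the current state. Strong connectivity bounds the differences of
  relative values, so Brouwer's theorem applied to a truncated Bellman operator gives a solution
  \<open>(g, f)\<close> of the average-reward optimality equation
  \<open>max\<^sub>q (I(q, W\<^sub>s) + \<Sum> P\<^sub>q(s'|s) f(s')) = g + f(s)\<close>, and the maximal block information is \<open>N g + O(1)\<close>.

  The optimality condition for the maximizing \<open>q\<^sub>s\<close> with output law \<open>r\<^sub>s\<close> says that for every input \<open>x\<close>
  the increment \<open>log (W(y,s'|x,s) / r\<^sub>s(y,s')) + f(s') - f(s) - g\<close> has mean at most \<open>0\<close>, and mean \<open>0\<close> when \<open>x\<close> is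
  drawn from \<open>q\<^sub>s\<close>. An exponential moment bound then keeps the information density below \<open>N (g + \<epsilon>)\<close>
  under every feedback code, which by a change of measure to the output law gives the converse.
  Under the stationary input law \<open>q\<close> it is at least \<open>N (g - \<epsilon>)\<close>; that law is a mixture of strategies
  that see the states only, to which Feinstein's construction applies.
\<close>

subsection \<open>Expectations along trajectories\<close>

abbreviation E :: "'a pmf \<Rightarrow> ('a \<Rightarrow> real) \<Rightarrow> real" where
  "E p f \<equiv> measure_pmf.expectation p f"

lemma expectation_bind_pmf:
  assumes "finite (set_pmf p)" and "\<And>x. x \<in> set_pmf p \<Longrightarrow> finite (set_pmf (k x))"
  shows "E (bind_pmf p k) f = E p (\<lambda>x. E (k x) f)"
proof -
  have "E (bind_pmf p k) f = (\<Sum>a\<in>set_pmf p. pmf p a *\<^sub>R E (k a) f)"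
    using assms by (intro pmf_expectation_bind) auto
  also have "\<dots> = E p (\<lambda>x. E (k x) f)"
    using assms(1) by (intro integral_measure_pmf[symmetric]) auto
  finally show ?thesis .
qed

lemma expectation_mono_pmf:
  assumes "finite (set_pmf p)" and "\<And>x. x \<in> set_pmf p \<Longrightarrow> f x \<le> g x"
  shows "E p f \<le> E p g"
  using assms by (intro integral_mono_AE) (auto simp: integrable_measure_pmf_finite AE_measure_pmf_iff)

lemma expectation_cong_pmf:
  assumes "\<And>x. x \<in> set_pmf p \<Longrightarrow> f x = g x"
  shows "E p f = E p g"
  using assms by (intro integral_cong_AE) (auto simp: AE_measure_pmf_iff)

lemma expectation_finite_type: "E p f = (\<Sum>x\<in>UNIV. pmf p (x :: 'a :: finite) * f x)"
  by (subst integral_measure_pmf[where A = UNIV]) auto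

definition extend :: "('x, 'y, 's) traj \<Rightarrow> 'x \<Rightarrow> 'y \<times> 's \<Rightarrow> ('x, 'y, 's) traj" where
  "extend h x a = (fst h, snd h @ [(x, a)])"

abbreviation cur_state :: "('x, 'y, 's) traj \<Rightarrow> 's" where
  "cur_state h \<equiv> last (traj_states h)"

lemma traj_states_extend [simp]: "traj_states (extend h x a) = traj_states h @ [snd a]"
  and traj_outputs_extend [simp]: "traj_outputs (extend h x a) = traj_outputs h @ [fst a]"
  and traj_inputs_extend [simp]: "traj_inputs (extend h x a) = traj_inputs h @ [x]"
  by (auto simp: extend_def traj_states_def traj_outputs_def traj_inputs_def split: prod.splits)

lemma fst_extend [simp]: "fst (extend h x a) = fst h"
  and length_extend [simp]: "length (snd (extend h x a)) = Suc (length (snd h))"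
  by (simp_all add: extend_def)

lemma length_traj_states [simp]: "length (traj_states h) = Suc (length (snd h))"
  and length_traj_outputs [simp]: "length (traj_outputs h) = length (snd h)"
  and length_traj_inputs [simp]: "length (traj_inputs h) = length (snd h)"
  by (simp_all add: traj_states_def traj_outputs_def traj_inputs_def)

lemma traj_states_not_Nil [simp]: "traj_states h \<noteq> []"
  by (simp add: traj_states_def)

lemma fsc_law_Suc:
  "fsc_law W p0 \<pi> (Suc n) = bind_pmf (fsc_law W p0 \<pi> n) (\<lambda>h.
     bind_pmf (\<pi> h) (\<lambda>x. map_pmf (extend h x) (W x (cur_state h))))"
  by (simp add: extend_def[abs_def] case_prod_unfold)

declare fsc_law.simps(2) [simp del]

text \<open>The induction runs over trajectories of positive probability only, so the extension step
  also supplies that the new input and the new output pair are possible.\<close>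

lemma fsc_law_induct [consumes 1, case_names Nil extend]:
  assumes "h \<in> set_pmf (fsc_law W p0 \<pi> n)"
    and "\<And>s. s \<in> set_pmf p0 \<Longrightarrow> P 0 (s, [])"
    and "\<And>n h x a. h \<in> set_pmf (fsc_law W p0 \<pi> n) \<Longrightarrow> P n h \<Longrightarrow> x \<in> set_pmf (\<pi> h) \<Longrightarrow>
           a \<in> set_pmf (W x (cur_state h)) \<Longrightarrow> P (Suc n) (extend h x a)"
  shows "P n h"
  using assms(1)
proof (induction n arbitrary: h)
  case 0
  then show ?case using assms(2) by auto
next
  case (Suc n)
  then show ?case using assms(3) by (auto simp: fsc_law_Suc)
qed

lemma length_fsc_law: "h \<in> set_pmf (fsc_law W p0 \<pi> n) \<Longrightarrow> length (snd h) = n"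
  by (induction rule: fsc_law_induct) auto

lemma fst_fsc_law: "h \<in> set_pmf (fsc_law W p0 \<pi> n) \<Longrightarrow> fst h \<in> set_pmf p0"
  by (induction rule: fsc_law_induct) auto

lemma finite_set_fsc_law [simp]:
  fixes W :: "('x::finite, 'y::finite, 's::finite) kernel"
  shows "finite (set_pmf (fsc_law W p0 \<pi> n))"
  by (induction n) (auto simp: fsc_law_Suc)

text \<open>A policy is consulted only at possible trajectories shorter than \<open>n\<close>. This
  lets a strategy be altered on longer histories or on histories from another initial state.\<close>

lemma fsc_law_cong:
  assumes "\<And>k h. k < n \<Longrightarrow> h \<in> set_pmf (fsc_law W p0 \<pi> k) \<Longrightarrow> \<pi> h = \<pi>' h"
  shows "fsc_law W p0 \<pi> n = fsc_law W p0 \<pi>' n"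
  using assms
proof (induction n)
  case (Suc n)
  have eq: "fsc_law W p0 \<pi> n = fsc_law W p0 \<pi>' n"
    by (rule Suc.IH) (rule Suc.prems, simp_all)
  have "\<pi> h = \<pi>' h" if "h \<in> set_pmf (fsc_law W p0 \<pi>' n)" for h
    using Suc.prems[of n h] that by (simp add: eq)
  then show ?case
    unfolding fsc_law_Suc eq by (intro bind_pmf_cong refl) simp
qed simp

lemma expectation_fsc_law_Suc:
  fixes W :: "('x::finite, 'y::finite, 's::finite) kernel"
  shows "E (fsc_law W p0 \<pi> (Suc n)) F =
    E (fsc_law W p0 \<pi> n) (\<lambda>h. E (\<pi> h) (\<lambda>x. E (W x (cur_state h)) (\<lambda>a. F (extend h x a))))"
  by (simp add: fsc_law_Suc expectation_bind_pmf)

section \<open>Additive functionals along a trajectory and their exponential concentration\<close>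

fun score_from :: "('s \<Rightarrow> 'x \<Rightarrow> 'y \<times> 's \<Rightarrow> real) \<Rightarrow> 's \<Rightarrow> ('x \<times> 'y \<times> 's) list \<Rightarrow> real" where
  "score_from \<phi> s [] = 0"
| "score_from \<phi> s ((x, a) # l) = \<phi> s x a + score_from \<phi> (snd a) l"

definition score :: "('s \<Rightarrow> 'x \<Rightarrow> 'y \<times> 's \<Rightarrow> real) \<Rightarrow> ('x, 'y, 's) traj \<Rightarrow> real" where
  "score \<phi> h = score_from \<phi> (fst h) (snd h)"

lemma cur_state_Cons: "cur_state (s, (x, a) # l) = cur_state (snd a, l)"
  by (simp add: traj_states_def case_prod_unfold)

lemma score_uminus: "score (\<lambda>s x a. - \<phi> s x a) h = - score \<phi> h"
proof -
  have "score_from (\<lambda>s x a. - \<phi> s x a) s l = - score_from \<phi> s l" for s l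
    by (induction \<phi> s l rule: score_from.induct) simp_all
  then show ?thesis by (simp add: score_def)
qed

lemma score_Nil [simp]: "score \<phi> (s, []) = 0"
  by (simp add: score_def)

text \<open>\<open>score_from\<close> recurses from the front of the list while the law appends at
  its end; the induction carries the last summand through the recursion.\<close>

lemma score_extend [simp]: "score \<phi> (extend h x a) = score \<phi> h + \<phi> (cur_state h) x a"
proof -
  have "score_from \<phi> s (l @ [(x, a)]) = score_from \<phi> s l + \<phi> (cur_state (s, l)) x a" for s l
    by (induction \<phi> s l rule: score_from.induct)
      (simp_all add: cur_state_Cons, simp add: traj_states_def)
  from this[of "fst h" "snd h"] show ?thesis
    by (simp add: score_def extend_def)
qed

text \<open>For negative \<open>x\<close> the quadratic Taylor bound for \<open>exp (- x)\<close>
  reduces the claim to a polynomial inequality.\<close>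

lemma exp_le_quadratic:
  fixes x :: real
  assumes "\<bar>x\<bar> \<le> 1"
  shows "exp x \<le> 1 + x + x\<^sup>2"
proof (cases "0 \<le> x")
  case True
  then show ?thesis using exp_bound[of x] assms by simp
next
  case False
  show ?thesis
  proof (cases "x = 0")
    case False
    with \<open>\<not> 0 \<le> x\<close> have "x < 0" by simp
    have "1 - x + x\<^sup>2 / 2 \<le> exp (- x)"
      using exp_lower_Taylor_quadratic[of "-x"] \<open>x < 0\<close> by simp
    moreover have "1 \<le> (1 + x + x\<^sup>2) * (1 - x + x\<^sup>2 / 2)"
    proof -
      have "(1 + x + x\<^sup>2) * (1 - x + x\<^sup>2 / 2) = 1 + x\<^sup>2 / 2 * (1 - x + x\<^sup>2)"
        by (simp add: power2_eq_square field_simps)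
      with \<open>x < 0\<close> show ?thesis by simp
    qed
    moreover have "0 \<le> 1 + x + x\<^sup>2" using assms by (simp add: abs_if split: if_splits)
    ultimately have "1 \<le> (1 + x + x\<^sup>2) * exp (- x)"
      using mult_left_mono order_trans by blast
    then show ?thesis by (simp add: exp_minus field_simps)
  qed simp
qed

text \<open>A supermartingale argument: given any history, nonpositive drift and the quadratic bound
  on \<open>exp\<close> make the conditional factor of the next step at most
  \<open>exp ((l * b)\<^sup>2)\<close>.\<close>

lemma exp_moment_score:
  fixes W :: "('x::finite, 'y::finite, 's::finite) kernel"
  assumes drift: "\<And>h. E (\<pi> h) (\<lambda>x. E (W x (cur_state h)) (\<phi> (cur_state h) x)) \<le> 0"
    and bound: "\<And>s x a. \<bar>\<phi> s x a\<bar> \<le> b"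
    and l: "0 \<le> l" "l * b \<le> 1"
  shows "E (fsc_law W p0 \<pi> n) (\<lambda>h. exp (l * score \<phi> h)) \<le> exp (n * (l * b)\<^sup>2)"
proof (induction n)
  case 0
  show ?case by simp
next
  case (Suc n)
  have inner: "E (\<pi> h) (\<lambda>x. E (W x (cur_state h)) (\<lambda>a. exp (l * \<phi> (cur_state h) x a)))
      \<le> exp ((l * b)\<^sup>2)" for h
  proof -
    have "exp (l * \<phi> s x a) \<le> 1 + (l * b)\<^sup>2 + l * \<phi> s x a" for s x a
    proof -
      have *: "\<bar>l * \<phi> s x a\<bar> \<le> l * b"
        using l bound by (simp add: abs_mult mult_left_mono)
      then have "(l * \<phi> s x a)\<^sup>2 \<le> (l * b)\<^sup>2"
        using abs_le_square_iff[of "l * \<phi> s x a" "l * b"] by linarith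
      then show ?thesis
        using exp_le_quadratic[of "l * \<phi> s x a"] * l by linarith
    qed
    then have "E (\<pi> h) (\<lambda>x. E (W x (cur_state h)) (\<lambda>a. exp (l * \<phi> (cur_state h) x a)))
      \<le> E (\<pi> h) (\<lambda>x. E (W x (cur_state h)) (\<lambda>a. 1 + (l * b)\<^sup>2 + l * \<phi> (cur_state h) x a))"
      by (intro expectation_mono_pmf) auto
    also have "\<dots> = 1 + (l * b)\<^sup>2 + l * E (\<pi> h) (\<lambda>x. E (W x (cur_state h)) (\<phi> (cur_state h) x))"
      by (simp add: integrable_measure_pmf_finite)
    also have "\<dots> \<le> 1 + (l * b)\<^sup>2"
      using drift[of h] l by (simp add: mult_nonneg_nonpos)
    also have "\<dots> \<le> exp ((l * b)\<^sup>2)" by (rule exp_ge_add_one_self)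
    finally show ?thesis .
  qed
  have "E (fsc_law W p0 \<pi> (Suc n)) (\<lambda>h. exp (l * score \<phi> h)) =
    E (fsc_law W p0 \<pi> n) (\<lambda>h. exp (l * score \<phi> h) *
       E (\<pi> h) (\<lambda>x. E (W x (cur_state h)) (\<lambda>a. exp (l * \<phi> (cur_state h) x a))))"
    by (simp add: expectation_fsc_law_Suc distrib_left exp_add)
  also have "\<dots> \<le> E (fsc_law W p0 \<pi> n) (\<lambda>h. exp (l * score \<phi> h) * exp ((l * b)\<^sup>2))"
    by (intro expectation_mono_pmf mult_left_mono inner) auto
  also have "\<dots> \<le> exp (n * (l * b)\<^sup>2) * exp ((l * b)\<^sup>2)"
    using Suc by simp
  also have "\<dots> = exp (Suc n * (l * b)\<^sup>2)"
    by (simp add: exp_add[symmetric] algebra_simps)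
  finally show ?case .
qed

lemma prob_as_expectation: "measure_pmf.prob p A = E p (indicator A)"
  by simp

text \<open>Chernoff's bound. The rate \<open>c\<close> is fixed before \<open>p0\<close>,
  \<open>\<pi>\<close> and \<open>n\<close>, so the estimate is uniform over all codes and block
  lengths.\<close>

lemma score_concentration:
  fixes W :: "('x::finite, 'y::finite, 's::finite) kernel"
  assumes "\<epsilon> > 0"
  shows "\<exists>c>0. \<forall>p0 \<pi> n. (\<forall>h. E (\<pi> h) (\<lambda>x. E (W x (cur_state h)) (\<phi> (cur_state h) x)) \<le> 0) \<longrightarrow>
      measure_pmf.prob (fsc_law W p0 \<pi> n) {h. real n * \<epsilon> \<le> score \<phi> h} \<le> exp (- c * real n)"
proof -
  \<comment> \<open>\<open>b\<close> dominates every value of \<phi>; the extra terms keep it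
    positive and at least \<epsilon>, which gives \<open>l * b \<le> 1\<close> for the
    \<open>l\<close> below.\<close>
  define b where "b = 1 + \<epsilon> + (\<Sum>s\<in>UNIV. \<Sum>x\<in>UNIV. \<Sum>a\<in>UNIV. \<bar>\<phi> s x a\<bar>)"
  have bound: "\<bar>\<phi> s x a\<bar> \<le> b" for s x a
  proof -
    have "\<bar>\<phi> s x a\<bar> \<le> (\<Sum>a\<in>UNIV. \<bar>\<phi> s x a\<bar>)"
      by (rule member_le_sum) auto
    also have "\<dots> \<le> (\<Sum>x\<in>UNIV. \<Sum>a\<in>UNIV. \<bar>\<phi> s x a\<bar>)"
      by (rule member_le_sum[of x _ "\<lambda>x. \<Sum>a\<in>UNIV. \<bar>\<phi> s x a\<bar>"]) (auto intro: sum_nonneg)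
    also have "\<dots> \<le> (\<Sum>s\<in>UNIV. \<Sum>x\<in>UNIV. \<Sum>a\<in>UNIV. \<bar>\<phi> s x a\<bar>)"
      by (rule member_le_sum[of s _ "\<lambda>s. \<Sum>x\<in>UNIV. \<Sum>a\<in>UNIV. \<bar>\<phi> s x a\<bar>"]) (auto intro!: sum_nonneg)
    finally show ?thesis using assms by (simp add: b_def)
  qed
  have b: "b \<ge> 1" "\<epsilon> \<le> b"
    using assms by (auto simp: b_def intro!: add_increasing2 sum_nonneg)
  \<comment> \<open>This \<open>l\<close> minimizes the exponent
    \<open>(l * b)\<^sup>2 - l * \<epsilon>\<close>.\<close>
  define l where "l = \<epsilon> / (2 * b\<^sup>2)"
  have l: "0 \<le> l" "l * b \<le> 1"
    using b assms by (auto simp: l_def power2_eq_square field_simps)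
  have lb: "(l * b)\<^sup>2 - l * \<epsilon> = - (\<epsilon>\<^sup>2 / (4 * b\<^sup>2))"
    using b by (simp add: l_def power2_eq_square field_simps)
  show ?thesis
  proof (intro exI[of _ "\<epsilon>\<^sup>2 / (4 * b\<^sup>2)"] conjI allI impI)
    show "\<epsilon>\<^sup>2 / (4 * b\<^sup>2) > 0" using assms b by simp
    fix p0 :: "'s pmf" and \<pi> :: "('x, 'y, 's) traj \<Rightarrow> 'x pmf" and n :: nat
    assume "\<forall>h. E (\<pi> h) (\<lambda>x. E (W x (cur_state h)) (\<phi> (cur_state h) x)) \<le> 0"
    then have drift: "\<And>h. E (\<pi> h) (\<lambda>x. E (W x (cur_state h)) (\<phi> (cur_state h) x)) \<le> 0"
      by blast
    have "measure_pmf.prob (fsc_law W p0 \<pi> n) {h. n * \<epsilon> \<le> score \<phi> h}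
      \<le> E (fsc_law W p0 \<pi> n) (\<lambda>h. exp (- (l * (n * \<epsilon>))) * exp (l * score \<phi> h))"
      unfolding prob_as_expectation
      by (intro expectation_mono_pmf)
        (auto simp: indicator_def exp_add[symmetric] l mult_left_mono)
    also have "\<dots> \<le> exp (- (l * (n * \<epsilon>))) * exp (n * (l * b)\<^sup>2)"
      using exp_moment_score[where \<pi> = \<pi> and W = W and \<phi> = \<phi>, OF drift bound l, of p0 n] by simp
    also have "\<dots> = exp (n * ((l * b)\<^sup>2 - l * \<epsilon>))"
      by (simp add: exp_add[symmetric] algebra_simps)
    also have "\<dots> = exp (- (\<epsilon>\<^sup>2 / (4 * b\<^sup>2)) * n)"
      unfolding lb by (simp add: mult.commute)
    finally show "measure_pmf.prob (fsc_law W p0 \<pi> n) {h. n * \<epsilon> \<le> score \<phi> h}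
      \<le> exp (- (\<epsilon>\<^sup>2 / (4 * b\<^sup>2)) * n)" .
  qed
qed

subsection \<open>Maximizing the one-step reward\<close>

definition output_pmf :: "('x, 'y, 's) kernel \<Rightarrow> 'x pmf \<Rightarrow> 's \<Rightarrow> ('y \<times> 's) pmf" where
  "output_pmf W q s = bind_pmf q (\<lambda>x. W x s)"

definition info_density :: "('x, 'y, 's) kernel \<Rightarrow> 'x pmf \<Rightarrow> 's \<Rightarrow> 'x \<Rightarrow> 'y \<times> 's \<Rightarrow> real" where
  "info_density W q s x a = log 2 (pmf (W x s) a / pmf (output_pmf W q s) a)"

text \<open>For \<open>f = 0\<close> this is the mutual information, in bits, between the input and
  the output pair in state \<open>s\<close>; in general \<open>f\<close> is the value assigned to
  the next state.\<close>

definition reward :: "('x, 'y, 's) kernel \<Rightarrow> ('s \<Rightarrow> real) \<Rightarrow> 's \<Rightarrow> 'x pmf \<Rightarrow> real" where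
  "reward W f s q = E q (\<lambda>x. E (W x s) (\<lambda>a. info_density W q s x a + f (snd a)))"

lemma pmf_output_pmf:
  fixes W :: "('x::finite, 'y::finite, 's::finite) kernel"
  shows "pmf (output_pmf W q s) a = (\<Sum>x\<in>UNIV. pmf q x * pmf (W x s) a)"
  by (simp add: output_pmf_def pmf_bind expectation_finite_type)

lemma pmf_output_pmf_pos:
  assumes "x \<in> set_pmf q" "a \<in> set_pmf (W x s)"
  shows "pmf (output_pmf W q s) a > 0"
  using assms by (auto simp: output_pmf_def pmf_positive_iff)

text \<open>Only the point 0 needs work: \<open>ln z \<le> z - 1\<close> at
  \<open>z = 1 / sqrt x\<close> bounds the absolute value by a multiple of
  \<open>sqrt x\<close>.\<close>

lemma continuous_on_x_log_x: "continuous_on {0..} (\<lambda>x::real. x * log 2 x)"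
proof -
  have "((\<lambda>x::real. x * log 2 x) \<longlongrightarrow> 0) (at 0 within {0..})"
  proof (rule Lim_null_comparison)
    have "norm (x * log 2 x) \<le> 2 * sqrt x / ln 2" if "0 \<le> x" "x < 1" for x :: real
    proof (cases "x = 0")
      case False
      with that have x: "0 < x" "x < 1" by auto
      have "x * - ln x = 2 * (x * ln (1 / sqrt x))"
        using x by (simp add: ln_div ln_sqrt)
      also have "\<dots> \<le> 2 * (x * (1 / sqrt x - 1))"
        using x by (intro mult_left_mono ln_le_minus_one) auto
      also have "\<dots> \<le> 2 * sqrt x"
        using x by (simp add: right_diff_distrib real_div_sqrt)
      finally show ?thesis
        using x divide_right_mono[of "- (x * ln x)" "2 * sqrt x" "ln 2"]
        by (simp add: log_def abs_mult)
    qed simp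
    then show "\<forall>\<^sub>F x in at 0 within {0..}. norm (x * log 2 x) \<le> 2 * sqrt x / ln (2::real)"
      unfolding eventually_at by (intro exI[of _ 1]) (auto simp: dist_real_def)
    show "((\<lambda>x. 2 * sqrt x / ln (2::real)) \<longlongrightarrow> 0) (at 0 within {0..})"
      by (auto intro!: tendsto_eq_intros)
  qed
  then have "continuous (at 0 within {0..}) (\<lambda>x::real. x * log 2 x)"
    by (simp add: continuous_within)
  moreover have "continuous (at x within {0..}) (\<lambda>x::real. x * log 2 x)" if "x > 0" for x
    using that by (intro continuous_intros) auto
  ultimately show ?thesis
    unfolding continuous_on_eq_continuous_within by (metis atLeast_iff less_eq_real_def)
qed

text \<open>Splitting the logarithm leaves a part linear in \<open>q\<close> plus the output
  entropy, a form without quotients and hence continuous up to the boundary of the simplex.\<close>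

lemma reward_eq_entropy_form:
  fixes W :: "('x::finite, 'y::finite, 's::finite) kernel"
  shows "reward W f s q =
    (\<Sum>x\<in>UNIV. pmf q x * (\<Sum>a\<in>UNIV. pmf (W x s) a * (log 2 (pmf (W x s) a) + f (snd a))))
    - (\<Sum>a\<in>UNIV. pmf (output_pmf W q s) a * log 2 (pmf (output_pmf W q s) a))"
proof -
  have "reward W f s q =
    (\<Sum>x\<in>UNIV. \<Sum>a\<in>UNIV. pmf q x * (pmf (W x s) a * (log 2 (pmf (W x s) a) + f (snd a)))
      - pmf q x * pmf (W x s) a * log 2 (pmf (output_pmf W q s) a))"
    unfolding reward_def info_density_def expectation_finite_type sum_distrib_left
  proof (intro sum.cong refl)
    fix x a
    show "pmf q x * (pmf (W x s) a *
        (log 2 (pmf (W x s) a / pmf (output_pmf W q s) a) + f (snd a))) =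
      pmf q x * (pmf (W x s) a * (log 2 (pmf (W x s) a) + f (snd a)))
      - pmf q x * pmf (W x s) a * log 2 (pmf (output_pmf W q s) a)"
    proof (cases "pmf q x = 0 \<or> pmf (W x s) a = 0")
      case False
      then have "pmf (W x s) a > 0" "pmf (output_pmf W q s) a > 0"
        using pmf_output_pmf_pos[of x q a W s] by (auto simp: set_pmf_iff pmf_pos)
      then show ?thesis by (simp add: log_divide algebra_simps)
    qed auto
  qed
  also have "\<dots> = (\<Sum>x\<in>UNIV. pmf q x * (\<Sum>a\<in>UNIV. pmf (W x s) a * (log 2 (pmf (W x s) a) + f (snd a))))
    - (\<Sum>x\<in>UNIV. \<Sum>a\<in>UNIV. pmf q x * pmf (W x s) a * log 2 (pmf (output_pmf W q s) a))"
    by (simp add: sum_subtractf sum_distrib_left)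
  also have "(\<Sum>x\<in>UNIV. \<Sum>a\<in>UNIV. pmf q x * pmf (W x s) a * log 2 (pmf (output_pmf W q s) a)) =
    (\<Sum>a\<in>UNIV. pmf (output_pmf W q s) a * log 2 (pmf (output_pmf W q s) a))"
    by (subst sum.swap) (simp add: pmf_output_pmf sum_distrib_right)
  finally show ?thesis .
qed

text \<open>A continuous function on the compact simplex attains its maximum; input laws are coded
  as vectors to have a topology at hand.\<close>

lemma reward_attains_max:
  fixes W :: "('x::finite, 'y::finite, 's::finite) kernel"
  shows "\<exists>q. \<forall>q'. reward W f s q' \<le> reward W f s q"
proof -
  define S where "S = {v :: real ^ 'x. (\<forall>x. 0 \<le> v $ x) \<and> (\<Sum>x\<in>UNIV. v $ x) = 1}"
  define G where "G v =
    (\<Sum>x\<in>UNIV. v $ x * (\<Sum>a\<in>UNIV. pmf (W x s) a * (log 2 (pmf (W x s) a) + f (snd a))))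
    - (\<Sum>a\<in>UNIV. (\<Sum>x\<in>UNIV. v $ x * pmf (W x s) a) * log 2 (\<Sum>x\<in>UNIV. v $ x * pmf (W x s) a))"
    for v :: "real ^ 'x"
  have G: "reward W f s q = G (\<chi> x. pmf q x)" for q
    by (simp add: reward_eq_entropy_form G_def pmf_output_pmf)
  have mem: "(\<chi> x. pmf q x) \<in> S" for q :: "'x pmf"
    using sum_pmf_eq_1[of UNIV q] by (simp add: S_def)
  have "closed S"
    unfolding S_def Collect_conj_eq
    by (intro closed_Int closed_Collect_all closed_Collect_le closed_Collect_eq continuous_intros)
  moreover have "bounded S"
  proof (rule boundedI)
    fix v assume "v \<in> S"
    then have "norm v \<le> (\<Sum>x\<in>UNIV. \<bar>v $ x\<bar>)" "(\<Sum>x\<in>UNIV. \<bar>v $ x\<bar>) = 1"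
      using norm_le_l1_cart[of v] by (auto simp: S_def)
    then show "norm v \<le> 1" by simp
  qed
  ultimately have "compact S" by (simp add: compact_eq_bounded_closed)
  moreover have "S \<noteq> {}" using mem by blast
  moreover have "continuous_on S G"
  proof -
    have "continuous_on S (\<lambda>v. (\<Sum>x\<in>UNIV. v $ x * pmf (W x s) a) * log 2 (\<Sum>x\<in>UNIV. v $ x * pmf (W x s) a))"
      for a
      by (rule continuous_on_compose2[OF continuous_on_x_log_x])
        (auto intro!: continuous_intros sum_nonneg simp: S_def)
    then show ?thesis
      unfolding G_def
      by (intro continuous_on_diff continuous_on_sum continuous_on_mult_right continuous_on_component continuous_on_id)
  qed
  ultimately obtain v where v: "v \<in> S" "\<forall>u\<in>S. G u \<le> G v"
    using continuous_attains_sup by blast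
  define q where "q = embed_pmf (\<lambda>x. v $ x)"
  have "pmf q x = v $ x" for x
    unfolding q_def
  proof (rule pmf_embed_pmf)
    show "0 \<le> v $ y" for y using v by (simp add: S_def)
    then show "(\<integral>\<^sup>+ y. ennreal (v $ y) \<partial>count_space UNIV) = 1"
      using v by (simp add: nn_integral_count_space_finite sum_ennreal S_def)
  qed
  then have "reward W f s q = G v"
    by (simp add: G vec_lambda_unique[symmetric])
  then have "\<forall>q'. reward W f s q' \<le> reward W f s q"
    using v mem by (simp add: G)
  then show ?thesis ..
qed

lemma reward_split:
  fixes W :: "('x::finite, 'y::finite, 's::finite) kernel"
  shows "reward W f s q = reward W (\<lambda>_. 0) s q + E (output_pmf W q s) (\<lambda>a. f (snd a))"
  by (simp add: reward_def output_pmf_def expectation_bind_pmf integrable_measure_pmf_finite)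

lemma reward_mono:
  fixes W :: "('x::finite, 'y::finite, 's::finite) kernel"
  assumes "\<And>s. f s \<le> g s + c"
  shows "reward W f s q \<le> reward W g s q + c"
proof -
  have "E (output_pmf W q s) (\<lambda>a. f (snd a)) \<le> E (output_pmf W q s) (\<lambda>a. g (snd a) + c)"
    by (intro expectation_mono_pmf assms) auto
  also have "\<dots> = E (output_pmf W q s) (\<lambda>a. g (snd a)) + c"
    by (simp add: integrable_measure_pmf_finite)
  finally show ?thesis by (subst (1 2) reward_split) simp
qed

text \<open>For a deterministic input the output law is the kernel itself, so every density is
  \<open>log 2 1 = 0\<close>.\<close>

lemma reward_return:
  fixes W :: "('x::finite, 'y::finite, 's::finite) kernel"
  shows "reward W f s (return_pmf x) = E (W x s) (\<lambda>a. f (snd a))"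
  unfolding reward_def
  by (auto intro!: expectation_cong_pmf simp: info_density_def output_pmf_def bind_return_pmf set_pmf_iff)

section \<open>First-order optimality conditions for the maximizing input law\<close>

lemma relative_entropy_nonneg:
  assumes "finite (set_pmf p)" and "\<And>a. a \<in> set_pmf p \<Longrightarrow> pmf r a > 0"
  shows "0 \<le> E p (\<lambda>a. log 2 (pmf p a / pmf r a))"
proof -
  have "0 \<le> (1 - (\<Sum>a\<in>set_pmf p. pmf r a)) / ln 2"
    using assms(1) by (simp add: measure_measure_pmf_finite[symmetric])
  also have "\<dots> = (\<Sum>a\<in>set_pmf p. pmf p a * ((1 - pmf r a / pmf p a) / ln 2))"
  proof -
    have "(\<Sum>a\<in>set_pmf p. pmf p a * ((1 - pmf r a / pmf p a) / ln 2)) =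
        (\<Sum>a\<in>set_pmf p. (pmf p a - pmf r a) / ln 2)"
      by (intro sum.cong) (auto simp: set_pmf_iff field_simps)
    then show ?thesis
      using assms(1) by (simp add: sum_divide_distrib[symmetric] sum_subtractf sum_pmf_eq_1)
  qed
  also have "\<dots> = E p (\<lambda>a. (1 - pmf r a / pmf p a) / ln 2)"
    using assms(1) by (subst integral_measure_pmf[of "set_pmf p"]) auto
  also have "\<dots> \<le> E p (\<lambda>a. log 2 (pmf p a / pmf r a))"
  proof (rule expectation_mono_pmf[OF assms(1)])
    fix a assume a: "a \<in> set_pmf p"
    then have pos: "pmf p a > 0" "pmf r a > 0" using assms(2) by (auto simp: pmf_positive_iff)
    then have "1 - pmf r a / pmf p a \<le> - ln (pmf r a / pmf p a)"
      using ln_le_minus_one[of "pmf r a / pmf p a"] by simp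
    also have "\<dots> = ln (pmf p a / pmf r a)" using pos by (simp add: ln_div)
    finally show "(1 - pmf r a / pmf p a) / ln 2 \<le> log 2 (pmf p a / pmf r a)"
      by (simp add: log_def divide_right_mono)
  qed
  finally show ?thesis .
qed

text \<open>Moving mass \<open>t\<close> from \<open>q\<close> to the input \<open>x\<close> cannot
  raise the reward. Measuring both laws against the perturbed output law, which is positive wherever
  \<open>W x s\<close> is, isolates the contribution of \<open>x\<close>.\<close>

lemma optimality_perturbed:
  fixes W :: "('x::finite, 'y::finite, 's::finite) kernel"
  assumes opt: "\<And>q'. reward W f s q' \<le> reward W f s q" and t: "0 < t" "t < 1"
  shows "E (W x s) (\<lambda>a. log 2 (pmf (W x s) a /
      (t * pmf (W x s) a + (1 - t) * pmf (output_pmf W q s) a)) + f (snd a)) \<le> reward W f s q"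
    (is "?D \<le> _")
proof -
  define q' where "q' = bind_pmf (bernoulli_pmf t) (\<lambda>b. if b then return_pmf x else q)"
  have E_q': "E q' F = t * F x + (1 - t) * E q F" for F
    using t unfolding q'_def by (subst expectation_bind_pmf) auto
  define r where "r = output_pmf W q s"
  define r' where "r' = output_pmf W q' s"
  have pmf_r': "pmf r' a = t * pmf (W x s) a + (1 - t) * pmf r a" for a
    by (simp add: r'_def r_def output_pmf_def pmf_bind E_q')
  have r'_pos: "pmf r' a > 0" if "pmf r a > 0" for a
    unfolding pmf_r' using that t by (intro add_nonneg_pos) auto
  \<comment> \<open>Replacing the output law \<open>r\<close> by \<open>r'\<close> inside the
    density adds the relative entropy of \<open>r\<close> with respect to \<open>r'\<close>, which
    is nonnegative.\<close>
  have "reward W f s q \<le> E q (\<lambda>x. E (W x s) (\<lambda>a. log 2 (pmf (W x s) a / pmf r' a) + f (snd a)))"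
  proof -
    have "0 \<le> E r (\<lambda>a. log 2 (pmf r a / pmf r' a))"
      by (rule relative_entropy_nonneg) (simp_all add: r'_pos pmf_positive_iff[symmetric] del: pmf_positive_iff)
    also have "\<dots> = E q (\<lambda>x. E (W x s) (\<lambda>a. log 2 (pmf r a / pmf r' a)))"
      unfolding r_def output_pmf_def by (simp add: expectation_bind_pmf)
    finally have "reward W f s q \<le> reward W f s q + \<dots>" by simp
    also have "\<dots> = E q (\<lambda>x. E (W x s) (\<lambda>a. info_density W q s x a + f (snd a)
        + log 2 (pmf r a / pmf r' a)))"
      by (simp add: reward_def integrable_measure_pmf_finite)
    also have "\<dots> = E q (\<lambda>x. E (W x s) (\<lambda>a. log 2 (pmf (W x s) a / pmf r' a) + f (snd a)))"
    proof (intro expectation_cong_pmf)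
      fix x a assume "x \<in> set_pmf q" "a \<in> set_pmf (W x s)"
      then have "pmf r a > 0" "pmf (W x s) a > 0" using pmf_output_pmf_pos[of x q a W s]
        by (auto simp: r_def pmf_positive_iff)
      then show "info_density W q s x a + f (snd a) + log 2 (pmf r a / pmf r' a) =
          log 2 (pmf (W x s) a / pmf r' a) + f (snd a)"
        using r'_pos[of a] by (simp add: info_density_def r_def[symmetric] log_divide)
    qed
    finally show ?thesis .
  qed
  then have "t * ?D + (1 - t) * reward W f s q \<le> reward W f s q'"
    using t by (simp add: reward_def[of _ _ _ q'] E_q' info_density_def r'_def[symmetric] pmf_r' r_def
        mult_left_mono)
  also have "\<dots> \<le> reward W f s q" by (rule opt)
  finally have "t * ?D \<le> t * reward W f s q" by (simp add: algebra_simps)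
  then show ?thesis using t by simp
qed

text \<open>If a possible output had mass 0 under the optimal output law, shifting mass
  \<open>t\<close> to \<open>x\<close> would gain \<open>log 2 (1 / t)\<close> at that output, too
  much for \<open>optimality_perturbed\<close> when \<open>t\<close> is small.\<close>

lemma optimal_output_pos:
  fixes W :: "('x::finite, 'y::finite, 's::finite) kernel"
  assumes opt: "\<And>q'. reward W f s q' \<le> reward W f s q" and a0: "pmf (W x s) a0 > 0"
  shows "pmf (output_pmf W q s) a0 > 0"
proof (rule ccontr)
  let ?w = "W x s" and ?r = "output_pmf W q s"
  assume "\<not> pmf ?r a0 > 0"
  then have r0: "pmf ?r a0 = 0" by (simp add: not_less order_antisym)
  define c where "c = E ?w (\<lambda>a. log 2 (pmf ?w a) + f (snd a))"
  \<comment> \<open>\<open>k\<close> is large enough for the gain at \<open>a0\<close> to beat the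
    deficit \<open>reward W f s q - c\<close>, and \<open>t\<close> is chosen so that
    \<open>log 2 (1 / t) = k\<close>.\<close>
  define k where "k = (1 + \<bar>reward W f s q - c\<bar>) / pmf ?w a0"
  define t :: real where "t = 2 powr (- k)"
  have k: "k > 0" "k * pmf ?w a0 > reward W f s q - c"
    using a0 by (auto simp: k_def)
  then have t: "0 < t" "t < 1" "log 2 t = - k"
    using powr_less_mono[of "-k" 0 2] by (auto simp: t_def)
  have "c + k * pmf ?w a0 = E ?w (\<lambda>a. log 2 (pmf ?w a) + f (snd a) + k * indicator {a0} a)"
    by (simp add: c_def integrable_measure_pmf_finite pmf.rep_eq)
  also have "\<dots> \<le> E ?w (\<lambda>a. log 2 (pmf ?w a / (t * pmf ?w a + (1 - t) * pmf ?r a)) + f (snd a))"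
  proof (rule expectation_mono_pmf)
    fix a assume "a \<in> set_pmf ?w"
    then have w: "0 < pmf ?w a" by (simp add: pmf_positive_iff)
    have "log 2 (pmf ?w a) + k * indicator {a0} a \<le>
        log 2 (pmf ?w a / (t * pmf ?w a + (1 - t) * pmf ?r a))"
    proof (cases "a = a0")
      case True
      have "log 2 (pmf ?w a) \<le> 0" using w by (simp add: pmf_le_1)
      then show ?thesis using True r0 w t a0 by (simp add: log_divide log_mult)
    next
      case False
      have "t * pmf ?w a + (1 - t) * pmf ?r a \<le> t * 1 + (1 - t) * 1"
        using t by (intro add_mono mult_left_mono pmf_le_1) auto
      moreover have "0 < t * pmf ?w a + (1 - t) * pmf ?r a"
        using t w by (intro add_pos_nonneg) auto
      ultimately show ?thesis using False w by (simp add: log_divide)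
    qed
    then show "log 2 (pmf ?w a) + f (snd a) + k * indicator {a0} a \<le>
        log 2 (pmf ?w a / (t * pmf ?w a + (1 - t) * pmf ?r a)) + f (snd a)" by simp
  qed simp
  also have "\<dots> \<le> reward W f s q"
    using optimality_perturbed[OF opt t(1,2)] .
  finally show False using k by simp
qed

text \<open>The Kuhn-Tucker condition, obtained by letting \<open>t\<close> tend to 0 in the
  perturbed inequality. Positivity of the optimal output law makes the logarithms continuous at the
  limit.\<close>

lemma optimality_all_inputs:
  fixes W :: "('x::finite, 'y::finite, 's::finite) kernel"
  assumes opt: "\<And>q'. reward W f s q' \<le> reward W f s q"
  shows "E (W x s) (\<lambda>a. info_density W q s x a + f (snd a)) \<le> reward W f s q"
proof -
  let ?w = "W x s" and ?r = "output_pmf W q s"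
  let ?G = "\<lambda>t. \<Sum>a\<in>set_pmf ?w. pmf ?w a *
      (log 2 (pmf ?w a / (t * pmf ?w a + (1 - t) * pmf ?r a)) + f (snd a))"
  have pos: "0 < pmf ?w a \<and> 0 < pmf ?r a" if "a \<in> set_pmf ?w" for a
    using that optimal_output_pos[OF opt, of x a] by (simp add: pmf_positive)
  have "(?G \<longlongrightarrow> (\<Sum>a\<in>set_pmf ?w. pmf ?w a * (log 2 (pmf ?w a / (0 * pmf ?w a + (1 - 0) * pmf ?r a)) + f (snd a))))
      (at_right 0)"
    by (intro tendsto_intros) (auto dest: pos)
  moreover have "\<forall>\<^sub>F t in at_right 0. ?G t \<le> reward W f s q"
  proof -
    have "?G t \<le> reward W f s q" if "0 < t" "t < 1" for t
      using optimality_perturbed[OF opt that, of x]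
      by (subst (asm) integral_measure_pmf[of "set_pmf ?w"]) auto
    then show ?thesis by (auto simp: eventually_at_right_field intro!: exI[of _ 1])
  qed
  ultimately have "(\<Sum>a\<in>set_pmf ?w. pmf ?w a * (log 2 (pmf ?w a / (0 * pmf ?w a + (1 - 0) * pmf ?r a)) + f (snd a)))
      \<le> reward W f s q"
    by (rule tendsto_upperbound) simp
  then show ?thesis
    by (subst integral_measure_pmf[of "set_pmf ?w"]) (auto simp: info_density_def)
qed

subsection \<open>The average-reward optimality equation\<close>

definition greedy :: "('x, 'y, 's) kernel \<Rightarrow> ('s \<Rightarrow> real) \<Rightarrow> 's \<Rightarrow> 'x pmf" where
  "greedy W f s = (SOME q. \<forall>q'. reward W f s q' \<le> reward W f s q)"

definition bellman :: "('x, 'y, 's) kernel \<Rightarrow> ('s \<Rightarrow> real) \<Rightarrow> 's \<Rightarrow> real" where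
  "bellman W f s = reward W f s (greedy W f s)"

lemma reward_le_bellman:
  fixes W :: "('x::finite, 'y::finite, 's::finite) kernel"
  shows "reward W f s q \<le> bellman W f s"
  unfolding bellman_def greedy_def using someI_ex[OF reward_attains_max[of W f s]] by blast

text \<open>The maximizer for \<open>f\<close> is a candidate for \<open>g\<close>. The bound makes
  the operator monotone and nonexpansive in the supremum norm.\<close>

lemma bellman_mono:
  fixes W :: "('x::finite, 'y::finite, 's::finite) kernel"
  assumes "\<And>s. f s \<le> g s + c"
  shows "bellman W f s \<le> bellman W g s + c"
proof -
  have "bellman W f s \<le> reward W g s (greedy W f s) + c"
    unfolding bellman_def[of W f] by (rule reward_mono[OF assms])
  then show ?thesis using reward_le_bellman[of W g s] by (smt (verit))
qed

text \<open>Test the maximum with a constant input, which carries no information, and keep one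
  successor; the others contribute nonnegatively.\<close>

lemma bellman_ge_successor:
  fixes W :: "('x::finite, 'y::finite, 's::finite) kernel"
  assumes "\<And>s. 0 \<le> f s"
  shows "pmf (W x s) a * f (snd a) \<le> bellman W f s"
proof -
  have "pmf (W x s) a * f (snd a) \<le> (\<Sum>a\<in>UNIV. pmf (W x s) a * f (snd a))"
    by (rule member_le_sum) (auto simp: assms)
  also have "\<dots> = reward W f s (return_pmf x)"
    by (simp add: reward_return expectation_finite_type)
  finally show ?thesis using reward_le_bellman[of W f s] order_trans by blast
qed

section \<open>Reachable states and the boundedness of relative values\<close>

definition channel_edges :: "('x, 'y, 's) kernel \<Rightarrow> ('s \<times> 's) set" where
  "channel_edges W = {(s, s'). \<exists>x y. (y, s') \<in> set_pmf (W x s)}"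

lemma state_at_reachable:
  assumes "h \<in> set_pmf (fsc_law W p0 \<pi> n)"
  shows "\<forall>t\<le>n. (fst h, state_at t h) \<in> (channel_edges W)\<^sup>*"
  using assms
proof (induction rule: fsc_law_induct)
  case (Nil s)
  then show ?case by (simp add: state_at_def traj_states_def)
next
  case (extend n h x a)
  have len: "length (snd h) = n" using extend.hyps(1) by (rule length_fsc_law)
  have "(cur_state h, snd a) \<in> channel_edges W"
    using extend.hyps(3) by (cases a) (auto simp: channel_edges_def)
  moreover have "state_at n h = cur_state h"
    using len last_conv_nth[of "traj_states h"] by (simp add: state_at_def)
  ultimately have "(fst h, snd a) \<in> (channel_edges W)\<^sup>*"
    using extend.IH by (metis order_refl rtrancl.rtrancl_into_rtrancl)
  then show ?case
    using extend.IH len by (auto simp: state_at_def nth_append le_Suc_eq)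
qed

text \<open>An event of positive probability contains a trajectory of positive probability, and its
  states form a path in the transition graph.\<close>

lemma strongly_connected_reachable:
  assumes "strongly_connected_fsc W"
  shows "(s, s') \<in> (channel_edges W)\<^sup>*"
proof -
  obtain Q T where prob: "measure_pmf.prob (fsc_law W (return_pmf s) (markov_rule Q) T)
      {h. \<exists>t\<in>{1..T}. state_at t h = s'} > 0" (is "measure_pmf.prob ?p ?A > 0")
    using assms unfolding strongly_connected_fsc_def by blast
  then have "set_pmf ?p \<inter> ?A \<noteq> {}"
    using measure_pmf_zero_iff[of ?p ?A] by simp
  then obtain h where h: "h \<in> set_pmf ?p" "\<exists>t\<in>{1..T}. state_at t h = s'"
    by blast
  then obtain t where "t \<le> T" "state_at t h = s'"
    by auto
  then show ?thesis
    using state_at_reachable[OF h(1)] fst_fsc_law[OF h(1)] by auto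
qed

text \<open>
  The bound does not depend on \<open>K\<close>, so a large \<open>K\<close> makes the truncation at \<open>K\<close> ineffective.
\<close>
lemma truncated_value_bounded:
  assumes "(a, b) \<in> (channel_edges W)\<^sup>*" and "0 \<le> B"
  shows "\<exists>k\<ge>0. \<forall>K>k. \<forall>h. (\<forall>s x y s'. min K (pmf (W x s) (y, s') * h s' - B) \<le> h s) \<longrightarrow>
    h a = 0 \<longrightarrow> h b \<le> (k :: real)"
  using assms(1)
proof (induction rule: rtrancl_induct)
  case base
  show ?case by (intro exI[of _ 0]) auto
next
  case (step b c)
  then obtain k where k: "k \<ge> 0"
    "\<And>K h. K > k \<Longrightarrow> (\<And>s x y s'. min K (pmf (W x s) (y, s') * h s' - B) \<le> h s) \<Longrightarrow> h a = 0 \<Longrightarrow> h b \<le> k"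
    by metis
  obtain x y where xy: "(y, c) \<in> set_pmf (W x b)"
    using step(2) by (auto simp: channel_edges_def)
  define p where "p = pmf (W x b) (y, c)"
  have p: "0 < p" "p \<le> 1" using xy by (auto simp: p_def pmf_positive pmf_le_1)
  have k': "k \<le> (k + B) / p"
    using p k(1) assms(2) by (simp add: le_divide_eq) (smt (verit) mult_left_le)
  show ?case
  proof (intro exI[of _ "(k + B) / p"] conjI allI impI)
    show "0 \<le> (k + B) / p" using k' k(1) by simp
    fix K h
    assume K: "(k + B) / p < K" and h: "\<forall>s x y s'. min K (pmf (W x s) (y, s') * h s' - B) \<le> h s"
      and "h a = 0"
    then have "h b \<le> k" using k(2)[of K h] k' by auto
    moreover have "min K (p * h c - B) \<le> h b" using h unfolding p_def by blast
    \<comment> \<open>Since \<open>h b \<le> k < K\<close>, the minimum is not \<open>K\<close>, so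
      the bound on \<open>h b\<close> passes to the second argument and can be solved for
      \<open>h c\<close>.\<close>
    ultimately have "p * h c - B \<le> k" using K k' by linarith
    then show "h c \<le> (k + B) / p" using p by (simp add: field_simps)
  qed
qed

lemma continuous_on_nonexpansive:
  fixes F :: "'a::real_normed_vector \<Rightarrow> real"
  assumes "\<And>u v. F u \<le> F v + norm (u - v)"
  shows "continuous_on S F"
proof (rule continuous_onI)
  fix u and e :: real
  assume "0 < e"
  have "\<bar>F v - F u\<bar> \<le> dist v u" for v
    using assms[of u v] assms[of v u] by (simp add: dist_norm norm_minus_commute abs_le_iff)
  then show "\<exists>d>0. \<forall>v\<in>S. dist v u < d \<longrightarrow> dist (F v) (F u) \<le> e"
    using \<open>0 < e\<close> by (intro exI[of _ e]) (auto simp: dist_real_def intro: order_trans less_imp_le)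
qed

text \<open>Value vectors are normalized by the minimum of the Bellman values and cut at
  \<open>K\<close>, so they stay in a cube. At a Brouwer fixed point the cut turns out to be
  inactive, and the normalizing constant is \<open>g\<close>.\<close>

lemma average_reward_optimality:
  fixes W :: "('x::finite, 'y::finite, 's::finite) kernel"
  assumes "strongly_connected_fsc W"
  obtains g f where "0 \<le> g" and "\<And>s. 0 \<le> f s" and "\<And>s. bellman W f s = g + f s"
proof -
  \<comment> \<open>\<open>B\<close> bounds the immediate rewards and later the normalizing constant
    of the fixed point.\<close>
  define B where "B = (\<Sum>s\<in>UNIV. \<bar>bellman W (\<lambda>_. 0) s\<bar>)"
  have B: "bellman W (\<lambda>_. 0) s \<le> B" for s
    using member_le_sum[of s UNIV "\<lambda>s. \<bar>bellman W (\<lambda>_. 0) s\<bar>"] by (simp add: B_def)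
  have "0 \<le> B" by (simp add: B_def sum_nonneg)
  have "\<exists>k. \<forall>a b. 0 \<le> k a b \<and> (\<forall>K>k a b. \<forall>h. (\<forall>s x y s'. min K (pmf (W x s) (y, s') * h s' - B) \<le> h s) \<longrightarrow>
    h a = 0 \<longrightarrow> h b \<le> k a b)"
    using truncated_value_bounded[OF strongly_connected_reachable[OF assms] \<open>0 \<le> B\<close>] by metis
  then obtain k where k0: "\<And>a b. 0 \<le> k a b"
    and k: "\<And>a b K h. K > k a b \<Longrightarrow> (\<And>s x y s'. min K (pmf (W x s) (y, s') * h s' - B) \<le> h s) \<Longrightarrow>
      h a = 0 \<Longrightarrow> h b \<le> k a b"
    by metis
  \<comment> \<open>\<open>K\<close> strictly exceeds the bounds for all pairs of states at
    once.\<close>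
  define K where "K = 1 + (\<Sum>(a, b)\<in>UNIV. k a b)"
  have K: "k a b < K" for a b
    using member_le_sum[of "(a, b)" UNIV "\<lambda>(a, b). k a b"] k0 by (auto simp: K_def)
  have "0 < K" using K[of undefined undefined] k0[of undefined undefined] by linarith
  define m where "m v = Min (range (bellman W (($) v)))" for v :: "real ^ 's"
  have m: "m v \<le> bellman W (($) v) s" for v s
    by (simp add: m_def)
  define \<Phi> where "\<Phi> v = (\<chi> s. min K (bellman W (($) v) s - m v))" for v :: "real ^ 's"
  have lip: "bellman W (($) u) s \<le> bellman W (($) v) s + norm (u - v)" for u v :: "real ^ 's" and s
  proof (rule bellman_mono)
    fix s show "u $ s \<le> v $ s + norm (u - v)"
      using component_le_norm_cart[of "u - v" s] by simp
  qed
  have lip_m: "m u \<le> m v + norm (u - v)" for u v :: "real ^ 's"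
  proof -
    obtain s where "m v = bellman W (($) v) s"
      using Min_in[of "range (bellman W (($) v))"] unfolding m_def by (metis UNIV_not_empty finite finite_imageI image_is_empty imageE)
    then show ?thesis using lip[of u s v] m[of u s] by linarith
  qed
  have "continuous_on (cbox 0 (\<chi> s. K)) \<Phi>"
    unfolding \<Phi>_def
    by (intro continuous_on_vec_lambda continuous_on_min continuous_on_const continuous_on_diff
        continuous_on_nonexpansive lip lip_m)
  moreover have "\<Phi> \<in> cbox 0 (\<chi> s. K) \<rightarrow> cbox 0 (\<chi> s. K)"
    using m \<open>0 < K\<close> by (auto simp: mem_box_cart \<Phi>_def)
  moreover have "cbox 0 (\<chi> s. K) \<noteq> ({} :: (real ^ 's) set)"
    using \<open>0 < K\<close> by (simp add: interval_ne_empty_cart)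
  ultimately obtain v where v: "v \<in> cbox 0 (\<chi> s. K)" "\<Phi> v = v"
    using brouwer[of "cbox 0 (\<chi> s. K)" \<Phi>] by (metis compact_cbox convex_box(1))
  define f where "f = ($) v"
  have f: "f s = min K (bellman W f s - m v)" for s
    using arg_cong[OF v(2), of "\<lambda>u. u $ s"] by (simp add: \<Phi>_def f_def)
  have f_nonneg: "0 \<le> f s" for s
    using v(1) by (simp add: f_def mem_box_cart)
  obtain s0 where s0: "bellman W f s0 = m v"
    using Min_in[of "range (bellman W (($) v))"] unfolding m_def f_def by (metis UNIV_not_empty finite finite_imageI image_is_empty imageE)
  then have f_s0: "f s0 = 0" using f[of s0] \<open>0 < K\<close> by simp
  \<comment> \<open>At a state where \<open>f\<close> is largest, the Bellman value exceeds
    \<open>f\<close> by at most the immediate reward.\<close>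
  have "m v \<le> B"
  proof -
    obtain s1 where s1: "f s1 = Max (range f)"
      using Max_in[of "range f"] by (metis UNIV_not_empty finite finite_imageI image_is_empty imageE)
    have "bellman W f s1 \<le> bellman W (\<lambda>_. 0) s1 + f s1"
      by (rule bellman_mono) (simp add: s1)
    then show ?thesis using f[of s1] B[of s1] by linarith
  qed
  \<comment> \<open>The fixed point satisfies the premise of \<open>k\<close> with source
    \<open>s0\<close>, where \<open>f\<close> vanishes, and so stays below the cut.\<close>
  have "f s < K" for s
  proof -
    have "min K (pmf (W x s) (y, s') * f s' - B) \<le> f s" for s x y s'
      using bellman_ge_successor[of f W x s "(y, s')"] f_nonneg \<open>m v \<le> B\<close> by (subst (2) f) auto
    then have "f s \<le> k s0 s" using k[of s0 s K f] K f_s0 by blast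
    then show ?thesis using K[of s0 s] by linarith
  qed
  then have "bellman W f s = m v + f s" for s
    using f[of s] by (smt (verit))
  moreover have "0 \<le> m v"
  proof -
    obtain a where "a \<in> set_pmf (W undefined s0)" using set_pmf_not_empty by fast
    have "0 \<le> pmf (W undefined s0) a * f (snd a)" by (simp add: f_nonneg)
    also have "\<dots> \<le> m v" unfolding s0[symmetric] by (rule bellman_ge_successor) (rule f_nonneg)
    finally show ?thesis .
  qed
  ultimately show ?thesis using that f_nonneg by blast
qed

subsection \<open>The information expression as an accumulated reward\<close>

lemma distributed_pmf_finite:
  fixes X :: "'a \<Rightarrow> 'b::finite"
  assumes "N = count_space UNIV"
  shows "distributed (measure_pmf p) N X (\<lambda>x. ennreal (pmf (map_pmf X p) x))"
  unfolding distributed_def assms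
  by (simp add: map_pmf_rep_eq[symmetric] measure_pmf_eq_density[symmetric])

text \<open>The generic integral formula, specialized to counting measures with mass functions as
  densities.\<close>

lemma conditional_mutual_information_pmf:
  fixes X :: "'a \<Rightarrow> 'b::finite" and Y :: "'a \<Rightarrow> 'c::finite" and Z :: "'a \<Rightarrow> 'd::finite"
  shows "prob_space.conditional_mutual_information (measure_pmf p) 2
      (count_space UNIV) (count_space UNIV) (count_space UNIV) X Y Z =
    (\<Sum>x\<in>UNIV. \<Sum>y\<in>UNIV. \<Sum>z\<in>UNIV.
      pmf (map_pmf (\<lambda>h. (X h, Y h, Z h)) p) (x, y, z) *
      log 2 (pmf (map_pmf (\<lambda>h. (X h, Y h, Z h)) p) (x, y, z) /
        (pmf (map_pmf (\<lambda>h. (X h, Z h)) p) (x, z) *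
          (pmf (map_pmf (\<lambda>h. (Y h, Z h)) p) (y, z) / pmf (map_pmf Z p) z))))"
proof -
  interpret information_space "measure_pmf p" 2
    by unfold_locales simp
  have [simp]: "count_space UNIV \<Otimes>\<^sub>M count_space UNIV = count_space (UNIV :: ('e::finite \<times> 'f::finite) set)"
    by (simp add: pair_measure_count_space)
  let ?P = "pmf (map_pmf (\<lambda>h. (X h, Y h, Z h)) p)"
  let ?g = "\<lambda>(x, y, z). ?P (x, y, z) * log 2 (?P (x, y, z) /
        (pmf (map_pmf (\<lambda>h. (X h, Z h)) p) (x, z) *
          (pmf (map_pmf (\<lambda>h. (Y h, Z h)) p) (y, z) / pmf (map_pmf Z p) z)))"
  have "prob_space.conditional_mutual_information (measure_pmf p) 2 (count_space UNIV) (count_space UNIV) (count_space UNIV) X Y Z =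
      (\<integral>w. ?g w \<partial>(count_space UNIV \<Otimes>\<^sub>M count_space UNIV \<Otimes>\<^sub>M count_space UNIV))"
    by (rule conditional_mutual_information_generic_eq[where
          Px = "pmf (map_pmf X p)" and Pz = "pmf (map_pmf Z p)" and
          Pyz = "pmf (map_pmf (\<lambda>h. (Y h, Z h)) p)" and Pxz = "pmf (map_pmf (\<lambda>h. (X h, Z h)) p)" and
          Pxyz = ?P])
      (auto simp: sigma_finite_measure_count_space_finite distributed_pmf_finite integrable_count_space)
  also have "\<dots> = (\<Sum>w\<in>UNIV \<times> UNIV \<times> UNIV. ?g w)"
    by (simp add: lebesgue_integral_count_space_finite)
  also have "\<dots> = (\<Sum>x\<in>UNIV. \<Sum>y\<in>UNIV. \<Sum>z\<in>UNIV. ?g (x, y, z))"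
    by (simp only: sum.cartesian_product')
  finally show ?thesis by simp
qed

definition state_law :: "('x, 'y, 's) kernel \<Rightarrow> 's pmf \<Rightarrow> (('x, 'y, 's) traj \<Rightarrow> 'x pmf) \<Rightarrow> nat \<Rightarrow> 's pmf" where
  "state_law W p0 \<pi> n = map_pmf cur_state (fsc_law W p0 \<pi> n)"

lemma state_law_0 [simp]: "state_law W p0 \<pi> 0 = p0"
  by (simp add: state_law_def map_pmf_comp traj_states_def)

text \<open>After \<open>n\<close> uses the trajectory holds \<open>n + 1\<close> states, hence the
  index \<open>Suc n\<close>.\<close>

lemma markov_rule_fsc_law:
  "h \<in> set_pmf (fsc_law W p0 \<pi> n) \<Longrightarrow> markov_rule Q h = Q (Suc n) (cur_state h)"
  by (simp add: markov_rule_def length_fsc_law)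

lemma state_law_Suc:
  "state_law W p0 (markov_rule Q) (Suc n) =
    bind_pmf (state_law W p0 (markov_rule Q) n) (\<lambda>s. map_pmf snd (output_pmf W (Q (Suc n) s) s))"
  unfolding state_law_def fsc_law_Suc output_pmf_def map_bind_pmf bind_map_pmf
  by (intro bind_pmf_cong) (auto simp: markov_rule_fsc_law map_pmf_comp)

text \<open>Later channel uses do not affect the law of a prefix, so a single step can be studied at
  the horizon where it is the last one.\<close>

lemma fsc_law_take:
  assumes "n \<le> N"
  shows "map_pmf (\<lambda>h. (fst h, take n (snd h))) (fsc_law W p0 \<pi> N) = fsc_law W p0 \<pi> n"
  using assms
proof (induction N)
  case 0
  then show ?case by (simp add: map_pmf_comp)
next
  case (Suc N)
  show ?case
  proof (cases "n = Suc N")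
    case True
    then have "map_pmf (\<lambda>h. (fst h, take n (snd h))) (fsc_law W p0 \<pi> (Suc N)) =
        map_pmf id (fsc_law W p0 \<pi> (Suc N))"
      by (intro map_pmf_cong) (auto dest: length_fsc_law)
    then show ?thesis using True by simp
  next
    case False
    then have "n \<le> N" using Suc by simp
    have "map_pmf (\<lambda>h. (fst h, take n (snd h))) (fsc_law W p0 \<pi> (Suc N)) =
        bind_pmf (fsc_law W p0 \<pi> N) (\<lambda>h. return_pmf (fst h, take n (snd h)))"
      unfolding fsc_law_Suc map_bind_pmf
      by (intro bind_pmf_cong)
        (use \<open>n \<le> N\<close> in \<open>auto simp: map_pmf_comp extend_def dest: length_fsc_law\<close>)
    then show ?thesis using Suc.IH[OF \<open>n \<le> N\<close>] by (simp add: map_pmf_def)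
  qed
qed

lemma step_law:
  assumes "Suc k \<le> N"
  shows "map_pmf (\<lambda>h. ((output_at (Suc k) h, state_at (Suc k) h), input_at (Suc k) h, state_at k h))
      (fsc_law W p0 (markov_rule Q) N) =
    bind_pmf (state_law W p0 (markov_rule Q) k) (\<lambda>s.
      bind_pmf (Q (Suc k) s) (\<lambda>x. map_pmf (\<lambda>a. (a, x, s)) (W x s)))"
    (is "map_pmf ?f _ = _")
proof -
  have "map_pmf ?f (fsc_law W p0 (markov_rule Q) N) =
      map_pmf (\<lambda>h. ?f (fst h, take (Suc k) (snd h))) (fsc_law W p0 (markov_rule Q) N)"
  proof (intro map_pmf_cong refl)
    fix h assume "h \<in> set_pmf (fsc_law W p0 (markov_rule Q) N)"
    then have "length (snd h) = N" by (rule length_fsc_law)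
    then show "?f h = ?f (fst h, take (Suc k) (snd h))"
      using assms by (auto simp: output_at_def state_at_def input_at_def traj_outputs_def
          traj_states_def traj_inputs_def nth_Cons split: nat.split)
  qed
  also have "\<dots> = map_pmf ?f (fsc_law W p0 (markov_rule Q) (Suc k))"
    unfolding fsc_law_take[OF assms, symmetric] map_pmf_comp ..
  also have "\<dots> = bind_pmf (state_law W p0 (markov_rule Q) k) (\<lambda>s.
      bind_pmf (Q (Suc k) s) (\<lambda>x. map_pmf (\<lambda>a. (a, x, s)) (W x s)))"
    unfolding fsc_law_Suc state_law_def map_bind_pmf bind_map_pmf
  proof (intro bind_pmf_cong refl)
    fix h assume h: "h \<in> set_pmf (fsc_law W p0 (markov_rule Q) k)"
    then show "markov_rule Q h = Q (Suc k) (cur_state h)" by (rule markov_rule_fsc_law)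
    have "length (snd h) = k" using h by (rule length_fsc_law)
    then have "?f (extend h x a) = (a, x, cur_state h)" for x a
      by (simp add: output_at_def state_at_def input_at_def nth_append last_conv_nth
          length_0_conv[symmetric] del: length_0_conv)
    then show "map_pmf ?f (map_pmf (extend h x) (W x (cur_state h))) =
        map_pmf (\<lambda>a. (a, x, cur_state h)) (W x (cur_state h))" for x
      by (simp add: map_pmf_comp)
  qed
  finally show ?thesis .
qed

lemma pmf_map_expectation: "pmf (map_pmf f p) b = E p (\<lambda>a. if f a = b then 1 else 0)"
proof -
  have "(\<lambda>a. if f a = b then 1 else 0 :: real) = indicator (f -` {b})"
    by (auto simp: indicator_def)
  then show ?thesis by (simp add: pmf_map)
qed

text \<open>In the joint law of one step the masses of the state and of the input cancel inside the
  logarithm, which leaves the kernel over the output law.\<close>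

lemma step_information_eq_reward:
  fixes W :: "('x::finite, 'y::finite, 's::finite) kernel"
  assumes "Suc k \<le> N"
  shows "step_information W p0 Q N (Suc k) =
    E (state_law W p0 (markov_rule Q) k) (\<lambda>s. reward W (\<lambda>_. 0) s (Q (Suc k) s))"
proof -
  define \<mu> where "\<mu> = state_law W p0 (markov_rule Q) k"
  define q where "q = Q (Suc k)"
  define L where "L = fsc_law W p0 (markov_rule Q) N"
  define J where "J = bind_pmf \<mu> (\<lambda>s. bind_pmf (q s) (\<lambda>x. map_pmf (\<lambda>a. (a, x, s)) (W x s)))"
  let ?X = "\<lambda>h. (output_at (Suc k) h, state_at (Suc k) h)"
  have J: "map_pmf (\<lambda>h. (?X h, input_at (Suc k) h, state_at k h)) L = J"
    unfolding L_def J_def \<mu>_def q_def by (rule step_law[OF assms])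
  have J1: "map_pmf (\<lambda>h. (?X h, state_at k h)) L = map_pmf (\<lambda>(a, x, s). (a, s)) J"
    and J2: "map_pmf (\<lambda>h. (input_at (Suc k) h, state_at k h)) L = map_pmf (\<lambda>(a, x, s). (x, s)) J"
    and J3: "map_pmf (state_at k) L = map_pmf (\<lambda>(a, x, s). s) J"
    unfolding J[symmetric] by (simp_all add: map_pmf_comp)
  have E_J: "E J F = (\<Sum>s\<in>UNIV. pmf \<mu> s * (\<Sum>x\<in>UNIV. pmf (q s) x * (\<Sum>a\<in>UNIV. pmf (W x s) a * F (a, x, s))))" for F
  proof -
    have "E J F = E \<mu> (\<lambda>s. E (q s) (\<lambda>x. E (W x s) (\<lambda>a. F (a, x, s))))"
      by (simp add: J_def expectation_bind_pmf)
    then show ?thesis by (simp add: expectation_finite_type)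
  qed
  have pmf_J: "pmf J (a, x, s) = pmf \<mu> s * pmf (q s) x * pmf (W x s) a" for a x s
  proof -
    have "pmf J (a, x, s) = E J (\<lambda>z. if z = (a, x, s) then 1 else 0)"
      using pmf_map_expectation[of id J "(a, x, s)"] by simp
    also have "\<dots> = (\<Sum>s'\<in>UNIV. \<Sum>x'\<in>UNIV. \<Sum>a'\<in>UNIV.
        if a' = a then if x' = x then if s' = s then pmf \<mu> s' * pmf (q s') x' * pmf (W x' s') a' else 0 else 0 else 0)"
      unfolding E_J sum_distrib_left by (intro sum.cong) auto
    also have "\<dots> = pmf \<mu> s * pmf (q s) x * pmf (W x s) a" by simp
    finally show ?thesis .
  qed
  have pmf_J1: "pmf (map_pmf (\<lambda>(a, x, s). (a, s)) J) (a, s) = pmf \<mu> s * pmf (output_pmf W (q s) s) a" for a s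
  proof -
    have "pmf (map_pmf (\<lambda>(a, x, s). (a, s)) J) (a, s) = (\<Sum>s'\<in>UNIV. \<Sum>x'\<in>UNIV. \<Sum>a'\<in>UNIV.
        if a' = a then if s' = s then pmf \<mu> s' * (pmf (q s') x' * pmf (W x' s') a') else 0 else 0)"
      unfolding pmf_map_expectation E_J sum_distrib_left by (intro sum.cong) auto
    also have "\<dots> = (\<Sum>s'\<in>UNIV. if s' = s then (\<Sum>x'\<in>UNIV. pmf \<mu> s' * (pmf (q s') x' * pmf (W x' s') a)) else 0)"
      by (intro sum.cong) auto
    also have "\<dots> = pmf \<mu> s * pmf (output_pmf W (q s) s) a"
      by (simp add: pmf_output_pmf sum_distrib_left)
    finally show ?thesis .
  qed
  have pmf_J2: "pmf (map_pmf (\<lambda>(a, x, s). (x, s)) J) (x, s) = pmf \<mu> s * pmf (q s) x" for x s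
  proof -
    have "pmf (map_pmf (\<lambda>(a, x, s). (x, s)) J) (x, s) = (\<Sum>s'\<in>UNIV. \<Sum>x'\<in>UNIV.
        if x' = x then if s' = s then pmf \<mu> s' * pmf (q s') x' * (\<Sum>a'\<in>UNIV. pmf (W x' s') a') else 0 else 0)"
      unfolding pmf_map_expectation E_J sum_distrib_left by (intro sum.cong) (auto simp: mult.assoc)
    then show ?thesis by (simp add: sum_pmf_eq_1)
  qed
  have pmf_J3: "pmf (map_pmf (\<lambda>(a, x, s). s) J) s = pmf \<mu> s" for s
  proof -
    have "map_pmf (\<lambda>(a, x, s). s) J = \<mu>"
      by (simp add: J_def map_bind_pmf map_pmf_comp bind_return_pmf')
    then show ?thesis by simp
  qed
  have "step_information W p0 Q N (Suc k) = (\<Sum>a\<in>UNIV. \<Sum>x\<in>UNIV. \<Sum>s\<in>UNIV.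
      pmf J (a, x, s) * log 2 (pmf J (a, x, s) /
        (pmf (map_pmf (\<lambda>(a, x, s). (a, s)) J) (a, s) *
          (pmf (map_pmf (\<lambda>(a, x, s). (x, s)) J) (x, s) / pmf (map_pmf (\<lambda>(a, x, s). s) J) s))))"
    unfolding step_information_def conditional_mutual_information_pmf L_def[symmetric]
    by (simp only: J J1 J2 J3 diff_Suc_1)
  also have "\<dots> = (\<Sum>a\<in>UNIV. \<Sum>x\<in>UNIV. \<Sum>s\<in>UNIV.
      pmf \<mu> s * (pmf (q s) x * (pmf (W x s) a * info_density W (q s) s x a)))"
  proof (intro sum.cong refl)
    fix a x s
    show "pmf J (a, x, s) * log 2 (pmf J (a, x, s) /
        (pmf (map_pmf (\<lambda>(a, x, s). (a, s)) J) (a, s) *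
          (pmf (map_pmf (\<lambda>(a, x, s). (x, s)) J) (x, s) / pmf (map_pmf (\<lambda>(a, x, s). s) J) s))) =
      pmf \<mu> s * (pmf (q s) x * (pmf (W x s) a * info_density W (q s) s x a))"
      unfolding pmf_J pmf_J1 pmf_J2 pmf_J3
      by (cases "pmf \<mu> s = 0 \<or> pmf (q s) x = 0") (auto simp: info_density_def)
  qed
  also have "\<dots> = (\<Sum>s\<in>UNIV. \<Sum>x\<in>UNIV. \<Sum>a\<in>UNIV.
      pmf \<mu> s * (pmf (q s) x * (pmf (W x s) a * info_density W (q s) s x a)))"
    by (subst sum.swap, subst (2) sum.swap, subst sum.swap) (rule refl)
  also have "\<dots> = E \<mu> (\<lambda>s. reward W (\<lambda>_. 0) s (q s))"
    by (simp add: reward_def expectation_finite_type sum_distrib_left)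
  finally show ?thesis by (simp add: \<mu>_def q_def)
qed

text \<open>Adding the potential of the next state and subtracting that of the current one leaves
  boundary terms only. The potentials are arbitrary; later they are finite-horizon values or a
  constant sequence.\<close>

lemma block_information_telescope:
  fixes W :: "('x::finite, 'y::finite, 's::finite) kernel"
  shows "block_information W p0 N Q =
    (\<Sum>k<N. E (state_law W p0 (markov_rule Q) k) (\<lambda>s. reward W (f (Suc k)) s (Q (Suc k) s) - f k s))
    + E p0 (f 0) - E (state_law W p0 (markov_rule Q) N) (f N)"
proof -
  let ?\<mu> = "state_law W p0 (markov_rule Q)"
  have "E (?\<mu> k) (\<lambda>s. reward W (\<lambda>_. 0) s (Q (Suc k) s)) =
      E (?\<mu> k) (\<lambda>s. reward W (f (Suc k)) s (Q (Suc k) s) - f k s)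
      + E (?\<mu> k) (f k) - E (?\<mu> (Suc k)) (f (Suc k))" for k
    unfolding state_law_Suc
    by (subst expectation_bind_pmf) (auto simp: reward_split[of W "f (Suc k)"] integrable_measure_pmf_finite)
  then have "block_information W p0 N Q =
    (\<Sum>k<N. E (?\<mu> k) (\<lambda>s. reward W (f (Suc k)) s (Q (Suc k) s) - f k s)
      + (E (?\<mu> k) (f k) - E (?\<mu> (Suc k)) (f (Suc k))))"
    unfolding block_information_def
    by (simp add: sum.atLeast1_atMost_eq step_information_eq_reward add_diff_eq)
  then show ?thesis
    using sum_lessThan_telescope'[of "\<lambda>k. E (?\<mu> k) (f k)" N] by (simp add: sum.distrib)
qed

text \<open>Backward induction: with the remaining values as potentials, every summand of the
  telescoped form is at most 0, and is 0 for greedy laws.\<close>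

lemma block_information_attains_max:
  fixes W :: "('x::finite, 'y::finite, 's::finite) kernel"
  shows "\<exists>Q. \<forall>Q'. block_information W p0 N Q' \<le> block_information W p0 N Q"
proof -
  define v where "v k = (bellman W ^^ (N - k)) (\<lambda>_. 0)" for k
  have v: "bellman W (v (Suc k)) = v k" if "k < N" for k
  proof -
    have "N - k = Suc (N - Suc k)" using that by simp
    then show ?thesis by (simp add: v_def)
  qed
  have vN: "v N = (\<lambda>_. 0)" by (simp add: v_def)
  \<comment> \<open>The law used at step \<open>k\<close> leads to the state at time
    \<open>k\<close>, so it is greedy for \<open>v k\<close>.\<close>
  define Q where "Q k = greedy W (v k)" for k
  have "block_information W p0 N Q' \<le> E p0 (v 0)" for Q'
  proof -
    have "(\<Sum>k<N. E (state_law W p0 (markov_rule Q') k) (\<lambda>s. reward W (v (Suc k)) s (Q' (Suc k) s) - v k s))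
        \<le> (\<Sum>k<N. E (state_law W p0 (markov_rule Q') k) (\<lambda>s. 0))"
      by (intro sum_mono expectation_mono_pmf) (auto simp: v[symmetric] reward_le_bellman)
    then show ?thesis unfolding block_information_telescope[of W p0 N Q' v] vN by simp
  qed
  moreover have "block_information W p0 N Q = E p0 (v 0)"
    unfolding block_information_telescope[of W p0 N Q v] vN
    by (simp add: Q_def bellman_def[symmetric] v)
  ultimately show ?thesis by metis
qed

text \<open>With the constant potential \<open>f\<close> each summand is at most \<open>g\<close>,
  with equality for the greedy law, and the boundary terms stay within
  \<open>Max (range f)\<close>.\<close>

lemma max_block_information_rate:
  fixes W :: "('x::finite, 'y::finite, 's::finite) kernel"
  assumes f: "\<And>s. 0 \<le> f s" "\<And>s. bellman W f s = g + f s"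
  shows "(\<lambda>N. 1 / real N * (SUP Q. block_information W p0 N Q)) \<longlonglongrightarrow> g"
proof -
  define H where "H = Max (range f)"
  have H: "f s \<le> H" for s by (simp add: H_def)
  have Ef: "0 \<le> E p f" "E p f \<le> H" for p
    using expectation_mono_pmf[of p "\<lambda>_. 0" f] expectation_mono_pmf[of p f "\<lambda>_. H"] f(1) H by auto
  have upper: "block_information W p0 N Q \<le> N * g + H" for N Q
  proof -
    have "(\<Sum>k<N. E (state_law W p0 (markov_rule Q) k) (\<lambda>s. reward W f s (Q (Suc k) s) - f s))
        \<le> (\<Sum>k<N. E (state_law W p0 (markov_rule Q) k) (\<lambda>s. g))"
      using reward_le_bellman[of W f] f(2)
      by (intro sum_mono expectation_mono_pmf) (auto simp: diff_le_eq)
    then have "(\<Sum>k<N. E (state_law W p0 (markov_rule Q) k) (\<lambda>s. reward W f s (Q (Suc k) s) - f s)) \<le> N * g"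
      by simp
    then show ?thesis
      unfolding block_information_telescope[of W p0 N Q "\<lambda>_. f"]
      using Ef(2)[of p0] Ef(1)[of "state_law W p0 (markov_rule Q) N"] by linarith
  qed
  have lower: "N * g - H \<le> block_information W p0 N (\<lambda>_. greedy W f)" for N
    unfolding block_information_telescope[of W p0 N _ "\<lambda>_. f"]
    using Ef(1)[of p0] Ef(2)[of "state_law W p0 (markov_rule (\<lambda>_. greedy W f)) N"]
    by (simp add: bellman_def[symmetric] f(2))
  have "\<bar>1 / real N * (SUP Q. block_information W p0 N Q) - g\<bar> \<le> H / N" if "N > 0" for N
  proof -
    have "(SUP Q. block_information W p0 N Q) \<le> N * g + H"
      by (intro cSUP_least upper) auto
    moreover have "N * g - H \<le> (SUP Q. block_information W p0 N Q)"
      using lower upper by (intro cSUP_upper2[where x = "\<lambda>_. greedy W f"]) (auto intro!: bdd_aboveI)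
    ultimately show ?thesis using that by (auto simp: field_simps abs_le_iff)
  qed
  then have "\<forall>\<^sub>F N in sequentially. norm (1 / real N * (SUP Q. block_information W p0 N Q) - g) \<le> H / real N"
    by (intro eventually_sequentiallyI[of 1]) simp
  then have "(\<lambda>N. 1 / real N * (SUP Q. block_information W p0 N Q) - g) \<longlonglongrightarrow> 0"
    using lim_const_over_n by (rule Lim_null_comparison)
  then show ?thesis by (simp add: LIM_zero_iff)
qed

subsection \<open>Change of measure\<close>

lemma pmf_bind_Pair: "pmf (bind_pmf p (\<lambda>x. map_pmf (Pair x) (k x))) (a, b) = pmf p a * pmf (k a) b"
proof -
  have "pmf (map_pmf (Pair x) (k x)) (a, b) = indicator {a} x * pmf (k a) b" for x
  proof (cases "x = a")
    case True
    then show ?thesis by (simp add: pmf_map_inj' inj_on_def)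
  next
    case False
    then have "(a, b) \<notin> set_pmf (map_pmf (Pair x) (k x))" by auto
    then have "pmf (map_pmf (Pair x) (k x)) (a, b) = 0" unfolding set_pmf_iff by simp
    then show ?thesis using False by simp
  qed
  then show ?thesis by (simp add: pmf_bind) (simp add: pmf.rep_eq)
qed

text \<open>Appending a step is injective, so the probability of a trajectory is the product of its
  step probabilities.\<close>

lemma pmf_fsc_law_extend:
  fixes W :: "('x, 'y, 's) kernel"
  shows "pmf (fsc_law W p0 \<pi> (Suc n)) (extend h x a) =
    pmf (fsc_law W p0 \<pi> n) h * (pmf (\<pi> h) x * pmf (W x (cur_state h)) a)"
proof -
  let ?f = "\<lambda>(h, x, a). extend h x a :: ('x, 'y, 's) traj"
  have inj: "inj ?f" by (auto simp: inj_def extend_def prod_eq_iff)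
  have "fsc_law W p0 \<pi> (Suc n) = map_pmf ?f (bind_pmf (fsc_law W p0 \<pi> n) (\<lambda>h.
      map_pmf (Pair h) (bind_pmf (\<pi> h) (\<lambda>x. map_pmf (Pair x) (W x (cur_state h))))))"
    by (simp add: fsc_law_Suc map_bind_pmf map_pmf_comp)
  also have "pmf \<dots> (?f (h, x, a)) =
      pmf (fsc_law W p0 \<pi> n) h * (pmf (\<pi> h) x * pmf (W x (cur_state h)) a)"
    by (subst pmf_map_inj'[OF inj]) (simp add: pmf_bind_Pair)
  finally show ?thesis by simp
qed

text \<open>All that the decoder sees: the trajectory without its inputs.\<close>

definition observation :: "('x, 'y, 's) traj \<Rightarrow> 's list \<times> 'y list" where
  "observation h = (traj_states h, traj_outputs h)"

text \<open>If the next output pair depends on the past only through the current state, via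
  \<open>r\<close>, the observations evolve with \<open>r\<close> alone, whichever kernel and policy
  produce it.\<close>

lemma observation_law_eq:
  fixes W W' :: "('x, 'y, 's) kernel"
  assumes "\<And>h. bind_pmf (\<pi> h) (\<lambda>x. W x (cur_state h)) = r (cur_state h)"
    and "\<And>h. bind_pmf (\<pi>' h) (\<lambda>x. W' x (cur_state h)) = r (cur_state h)"
  shows "map_pmf observation (fsc_law W p0 \<pi> n) = map_pmf observation (fsc_law W' p0 \<pi>' n)"
proof (induction n)
  case 0
  show ?case by (simp add: map_pmf_comp observation_def traj_states_def traj_outputs_def)
next
  case (Suc n)
  define G where "G = (\<lambda>(ss, ys). map_pmf (\<lambda>a. (ss @ [snd a], ys @ [fst a])) (r (last ss) :: ('y \<times> 's) pmf))"
  have step: "map_pmf observation (fsc_law V p0 \<rho> (Suc n)) =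
      bind_pmf (map_pmf observation (fsc_law V p0 \<rho> n)) G"
    if "\<And>h. bind_pmf (\<rho> h) (\<lambda>x. V x (cur_state h)) = r (cur_state h)" for V :: "('x, 'y, 's) kernel" and \<rho>
    unfolding fsc_law_Suc map_bind_pmf bind_map_pmf
  proof (intro bind_pmf_cong refl)
    fix h
    have "bind_pmf (\<rho> h) (\<lambda>x. map_pmf observation (map_pmf (extend h x) (V x (cur_state h)))) =
        map_pmf (\<lambda>a. (traj_states h @ [snd a], traj_outputs h @ [fst a]))
          (bind_pmf (\<rho> h) (\<lambda>x. V x (cur_state h)))"
      by (simp add: map_bind_pmf map_pmf_comp observation_def)
    then show "bind_pmf (\<rho> h) (\<lambda>x. map_pmf observation (map_pmf (extend h x) (V x (cur_state h)))) =
        G (observation h)"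
      by (simp add: that G_def observation_def)
  qed
  show ?case unfolding step[of \<pi> W, OF assms(1)] step[of \<pi>' W', OF assms(2)] Suc ..
qed

text \<open>A reference channel whose output ignores the input. The input argument is kept so that
  the same policy can run on it and trajectories can be compared pointwise.\<close>

definition output_kernel :: "('x, 'y, 's) kernel \<Rightarrow> ('s \<Rightarrow> 'x pmf) \<Rightarrow> ('x, 'y, 's) kernel" where
  "output_kernel W q x s = output_pmf W (q s) s"

abbreviation density_score :: "('x, 'y, 's) kernel \<Rightarrow> ('s \<Rightarrow> 'x pmf) \<Rightarrow> ('x, 'y, 's) traj \<Rightarrow> real" where
  "density_score W q \<equiv> score (\<lambda>s. info_density W (q s) s)"

text \<open>The policy factors agree on both sides, so for every policy the likelihood ratio of the
  two channels is the product of the one-step ratios.\<close>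

lemma pmf_fsc_law_density:
  assumes pos: "\<And>s x a. pmf (W x s) a > 0 \<Longrightarrow> pmf (output_pmf W (q s) s) a > 0"
    and h: "h \<in> set_pmf (fsc_law W p0 \<pi> n)"
  shows "pmf (fsc_law W p0 \<pi> n) h =
    2 powr density_score W q h * pmf (fsc_law (output_kernel W q) p0 \<pi> n) h"
  using h
proof (induction rule: fsc_law_induct)
  case (extend n h x a)
  have "0 < pmf (W x (cur_state h)) a"
    using extend.hyps(3) by (simp add: pmf_positive)
  then have "pmf (W x (cur_state h)) a = 2 powr info_density W (q (cur_state h)) (cur_state h) x a *
      pmf (output_kernel W q x (cur_state h)) a"
    using pos[of x "cur_state h" a] by (simp add: info_density_def output_kernel_def)
  then show ?case
    by (simp add: pmf_fsc_law_extend extend.IH powr_add)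
qed simp

lemma prob_pmf_finite:
  assumes "finite (set_pmf p)"
  shows "measure_pmf.prob p A = (\<Sum>h\<in>set_pmf p \<inter> A. pmf p h)"
  using assms by (subst measure_Int_set_pmf[symmetric]) (simp add: measure_measure_pmf_finite Int_commute)

lemma prob_le_output_prob:
  fixes W :: "('x::finite, 'y::finite, 's::finite) kernel"
  assumes pos: "\<And>s x a. pmf (W x s) a > 0 \<Longrightarrow> pmf (output_pmf W (q s) s) a > 0"
    and A: "\<And>h. h \<in> A \<Longrightarrow> density_score W q h \<le> t"
  shows "measure_pmf.prob (fsc_law W p0 \<pi> n) A \<le>
    2 powr t * measure_pmf.prob (fsc_law (output_kernel W q) p0 \<pi> n) A"
proof -
  let ?P = "fsc_law W p0 \<pi> n" and ?R = "fsc_law (output_kernel W q) p0 \<pi> n"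
  have "measure_pmf.prob ?P A \<le> (\<Sum>h\<in>set_pmf ?P \<inter> A. 2 powr t * pmf ?R h)"
    unfolding prob_pmf_finite[OF finite_set_fsc_law]
  proof (rule sum_mono)
    fix h assume "h \<in> set_pmf ?P \<inter> A"
    then show "pmf ?P h \<le> 2 powr t * pmf ?R h"
      using A[of h] by (subst pmf_fsc_law_density[where W = W and q = q, OF pos]) (auto intro!: mult_right_mono)
  qed
  also have "\<dots> = 2 powr t * measure_pmf.prob ?R (set_pmf ?P \<inter> A)"
    by (simp add: sum_distrib_left measure_measure_pmf_finite)
  also have "\<dots> \<le> 2 powr t * measure_pmf.prob ?R A"
    by (intro mult_left_mono measure_pmf.finite_measure_mono) auto
  finally show ?thesis .
qed

text \<open>The likelihood ratio is read in the other direction; the sets lie in the support of the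
  true law because the ratio formula is stated there.\<close>

lemma output_prob_le:
  fixes W :: "('x::finite, 'y::finite, 's::finite) kernel"
  assumes pos: "\<And>s x a. pmf (W x s) a > 0 \<Longrightarrow> pmf (output_pmf W (q s) s) a > 0"
    and A: "\<And>h. h \<in> A \<Longrightarrow> h \<in> set_pmf (fsc_law W p0 \<pi> n) \<and> t < density_score W q h"
  shows "measure_pmf.prob (fsc_law (output_kernel W q) p0 \<pi> n) A \<le> 2 powr (- t)"
proof -
  let ?P = "fsc_law W p0 \<pi> n" and ?R = "fsc_law (output_kernel W q) p0 \<pi> n"
  have "measure_pmf.prob ?R A \<le> (\<Sum>h\<in>set_pmf ?R \<inter> A. 2 powr (- t) * pmf ?P h)"
    unfolding prob_pmf_finite[OF finite_set_fsc_law]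
  proof (rule sum_mono)
    fix h assume "h \<in> set_pmf ?R \<inter> A"
    then have h: "h \<in> set_pmf ?P" "t < density_score W q h" using A by auto
    have "1 \<le> 2 powr (- t) * 2 powr density_score W q h"
      using h(2) by (simp add: powr_add[symmetric] ge_one_powr_ge_zero)
    then have "pmf ?R h \<le> 2 powr (- t) * 2 powr density_score W q h * pmf ?R h"
      using mult_right_mono[of 1 _ "pmf ?R h"] by simp
    then show "pmf ?R h \<le> 2 powr (- t) * pmf ?P h"
      by (simp add: pmf_fsc_law_density[where W = W and q = q, OF pos h(1)] mult.assoc)
  qed
  also have "\<dots> = 2 powr (- t) * measure_pmf.prob ?P (set_pmf ?R \<inter> A)"
    by (simp add: sum_distrib_left measure_measure_pmf_finite)
  also have "\<dots> \<le> 2 powr (- t) * 1"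
    by (intro mult_left_mono) auto
  finally show ?thesis by simp
qed

subsection \<open>Random strategies\<close>

definition state_policy :: "('s list \<Rightarrow> 'x) \<Rightarrow> ('x, 'y, 's) traj \<Rightarrow> 'x pmf" where
  "state_policy u h = return_pmf (u (traj_states h))"

lemma finite_set_Pi_pmf:
  fixes p :: "'a \<Rightarrow> 'b::finite pmf"
  assumes "finite A"
  shows "finite (set_pmf (Pi_pmf A d p))"
  using set_Pi_pmf_subset[OF assms, of d p] finite_PiE_dflt[OF assms, of "\<lambda>_. UNIV" d]
  by (auto simp: PiE_dflt_def elim!: finite_subset)

text \<open>
  Drawing the input for every state history in advance does not change the law, since a trajectory
  uses each entry of the table at most once.
\<close>
lemma markov_rule_mixture:
  fixes W :: "('x::finite, 'y, 's::finite) kernel"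
  shows "\<exists>U. finite (set_pmf U) \<and>
    fsc_law W p0 (markov_rule Q) n = bind_pmf U (\<lambda>u. fsc_law W p0 (state_policy u) n)"
proof (induction n)
  case 0
  show ?case by (intro exI[of _ "return_pmf undefined"]) (simp add: bind_return_pmf)
next
  case (Suc n)
  then obtain U where U: "finite (set_pmf U)"
    "fsc_law W p0 (markov_rule Q) n = bind_pmf U (\<lambda>u. fsc_law W p0 (state_policy u) n)"
    by blast
  \<comment> \<open>The histories at which input number \<open>n + 1\<close> is chosen;
    \<open>V\<close> draws fresh table entries for exactly these.\<close>
  define S where "S = {ss :: 's list. length ss = Suc n}"
  have "finite S" using finite_lists_length_eq[OF finite_class.finite_UNIV, of "Suc n"] by (simp add: S_def)
  define V where "V = Pi_pmf S undefined (\<lambda>ss. Q (length ss) (last ss))"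
  define join :: "('s list \<Rightarrow> 'x) \<times> ('s list \<Rightarrow> 'x) \<Rightarrow> 's list \<Rightarrow> 'x"
    where "join = (\<lambda>(u, v) ss. if length ss \<le> n then u ss else v ss)"
  define U' where "U' = map_pmf join (pair_pmf U V)"
  have V: "map_pmf (\<lambda>v. v (traj_states h)) V = markov_rule Q h" if "length (snd h) = n"
    for h :: "('x, 'y, 's) traj"
    using that \<open>finite S\<close> by (simp add: V_def Pi_pmf_component S_def markov_rule_def)
  have join_law: "fsc_law W p0 (state_policy (join (u, v))) n = fsc_law W p0 (state_policy u) n" for u v
    by (rule fsc_law_cong) (simp add: state_policy_def join_def length_fsc_law)
  let ?step = "\<lambda>h x. map_pmf (extend h x) (W x (cur_state h))"
  have "bind_pmf U' (\<lambda>u. fsc_law W p0 (state_policy u) (Suc n)) =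
      bind_pmf U (\<lambda>u. bind_pmf V (\<lambda>v. bind_pmf (fsc_law W p0 (state_policy u) n) (\<lambda>h. ?step h (v (traj_states h)))))"
    unfolding U'_def bind_map_pmf pair_pmf_def bind_assoc_pmf bind_return_pmf fsc_law_Suc join_law
    by (intro bind_pmf_cong refl)
      (auto simp: state_policy_def bind_return_pmf join_def length_fsc_law)
  \<comment> \<open>The draw of \<open>v\<close> commutes past the trajectory, which does not depend
    on it; then only the entry at the current history is read.\<close>
  also have "\<dots> = bind_pmf U (\<lambda>u. bind_pmf (fsc_law W p0 (state_policy u) n)
      (\<lambda>h. bind_pmf (map_pmf (\<lambda>v. v (traj_states h)) V) (?step h)))"
    by (subst bind_commute_pmf) (simp add: bind_map_pmf)
  also have "\<dots> = bind_pmf U (\<lambda>u. bind_pmf (fsc_law W p0 (state_policy u) n)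
      (\<lambda>h. bind_pmf (markov_rule Q h) (?step h)))"
    by (intro bind_pmf_cong refl) (auto simp: V length_fsc_law)
  also have "\<dots> = fsc_law W p0 (markov_rule Q) (Suc n)"
    by (simp add: fsc_law_Suc U(2) bind_assoc_pmf)
  finally have "fsc_law W p0 (markov_rule Q) (Suc n) =
      bind_pmf U' (\<lambda>u. fsc_law W p0 (state_policy u) (Suc n))" ..
  moreover have "finite (set_pmf U')"
    unfolding U'_def V_def set_map_pmf set_pair_pmf
    by (intro finite_imageI finite_cartesian_product U(1) finite_set_Pi_pmf \<open>finite S\<close>)
  ultimately show ?case by blast
qed

text \<open>Under a deterministic state strategy the inputs are a function of the states, so a
  possible trajectory can be recovered from its observation. This lets decoding sets refer to the
  density score.\<close>

definition rebuild :: "('s list \<Rightarrow> 'x) \<Rightarrow> 's list \<times> 'y list \<Rightarrow> ('x, 'y, 's) traj" where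
  "rebuild u ob = (hd (fst ob),
    map (\<lambda>i. (u (take (Suc i) (fst ob)), snd ob ! i, fst ob ! Suc i)) [0..<length (snd ob)])"

lemma rebuild_observation:
  assumes "h \<in> set_pmf (fsc_law W p0 (state_policy u) n)"
  shows "rebuild u (observation h) = h"
  using assms
proof (induction rule: fsc_law_induct)
  case (Nil s)
  show ?case by (simp add: rebuild_def observation_def traj_states_def traj_outputs_def)
next
  case (extend n h x a)
  have len: "length (snd h) = n" using extend.hyps(1) by (rule length_fsc_law)
  have hd: "hd (traj_states h @ [snd a]) = hd (traj_states h)"
    by simp
  have "map (\<lambda>i. (u (take (Suc i) (traj_states h @ [snd a])), (traj_outputs h @ [fst a]) ! i,
      (traj_states h @ [snd a]) ! Suc i)) [0..<n] =
    map (\<lambda>i. (u (take (Suc i) (traj_states h)), traj_outputs h ! i, traj_states h ! Suc i)) [0..<n]"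
    using len by (intro map_cong) (auto simp: nth_append)
  then have "rebuild u (observation (extend h x a)) =
      (fst (rebuild u (observation h)), snd (rebuild u (observation h)) @ [(u (traj_states h), a)])"
    using len by (simp add: rebuild_def observation_def nth_append hd)
  then show ?case using extend.IH extend.hyps(2) by (simp add: extend_def state_policy_def)
qed

subsection \<open>The converse\<close>

lemma score_potential:
  assumes "h \<in> set_pmf (fsc_law W p0 \<pi> n)"
  shows "score (\<lambda>s x a. info_density W (q s) s x a + f (snd a) - f s - g) h =
    density_score W q h + f (cur_state h) - f (fst h) - n * g"
  using assms
proof (induction rule: fsc_law_induct)
  case (Nil s)
  show ?case by (simp add: traj_states_def)
next
  case (extend n h x a)
  then show ?case by (simp add: algebra_simps)
qed

lemma prob_mono_support:
  assumes "\<And>h. h \<in> set_pmf p \<Longrightarrow> h \<in> A \<Longrightarrow> h \<in> B"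
  shows "measure_pmf.prob p A \<le> measure_pmf.prob p B"
  using assms by (intro measure_pmf.finite_measure_mono_AE) (auto simp: AE_measure_pmf_iff)

lemma num_messages_ge: "2 powr (real N * R) \<le> real (num_messages N R)"
  by (simp add: num_messages_def of_nat_ceiling)

lemma num_messages_pos: "0 < num_messages N R"
  by (simp add: num_messages_def)

lemma num_messages_le:
  assumes "0 \<le> R"
  shows "real (num_messages N R) \<le> 2 * 2 powr (real N * R)"
proof -
  have "1 \<le> 2 powr (real N * R)" using assms by (simp add: ge_one_powr_ge_zero)
  moreover have "real (num_messages N R) \<le> 2 powr (real N * R) + 1"
    unfolding num_messages_def by (simp add: less_imp_le)
  ultimately show ?thesis by linarith
qed

lemma exp_linear_tendsto_0:
  assumes "c > 0"
  shows "(\<lambda>n. exp (- c * real n)) \<longlonglongrightarrow> 0"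
proof -
  have "exp (- c * real n) = exp (- c) ^ n" for n
    by (simp add: exp_of_nat_mult[symmetric] mult.commute)
  then show ?thesis using assms by (simp add: LIMSEQ_realpow_zero)
qed

text \<open>A solution of the optimality equation with a maximizing stationary input law, shared by
  converse and achievability.\<close>

locale average_reward_solution =
  fixes W :: "('x::finite, 'y::finite, 's::finite) kernel"
    and g :: real and f :: "'s \<Rightarrow> real" and q :: "'s \<Rightarrow> 'x pmf"
  assumes f_nonneg: "0 \<le> f s"
    and q_optimal: "reward W f s q' \<le> reward W f s (q s)"
    and reward_q: "reward W f s (q s) = g + f s"
begin

definition drift :: "'s \<Rightarrow> 'x \<Rightarrow> 'y \<times> 's \<Rightarrow> real" where
  "drift s x a = info_density W (q s) s x a + f (snd a) - f s - g"

lemma output_pos: "pmf (W x s) a > 0 \<Longrightarrow> pmf (output_pmf W (q s) s) a > 0"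
  using optimal_output_pos[OF q_optimal] .

lemma expectation_drift_le: "E (W x s) (drift s x) \<le> 0"
proof -
  have "E (W x s) (drift s x) = E (W x s) (\<lambda>a. info_density W (q s) s x a + f (snd a)) - f s - g"
    by (simp add: drift_def[abs_def] integrable_measure_pmf_finite)
  then show ?thesis
    using optimality_all_inputs[OF q_optimal, of x s] reward_q[of s] by simp
qed

lemma expectation_drift_q: "E (q s) (\<lambda>x. E (W x s) (drift s x)) = 0"
proof -
  have "E (q s) (\<lambda>x. E (W x s) (drift s x)) = reward W f s (q s) - f s - g"
    by (simp add: drift_def[abs_def] reward_def integrable_measure_pmf_finite)
  then show ?thesis using reward_q[of s] by simp
qed

lemma score_drift:
  assumes "h \<in> set_pmf (fsc_law W p0 \<pi> n)"
  shows "\<bar>score drift h - (density_score W q h - n * g)\<bar> \<le> Max (range f)"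
proof -
  have "f s \<le> Max (range f)" for s by simp
  then have "\<bar>f (cur_state h) - f (fst h)\<bar> \<le> Max (range f)"
    using f_nonneg by (smt (verit))
  then show ?thesis
    using score_potential[OF assms, of q f g] by (simp add: drift_def[abs_def])
qed

text \<open>The drift has nonpositive mean for every single input, so concentration applies to all
  policies, feedback included. One \<epsilon> pays for the deviation, the other for the bounded
  potential once \<open>n\<close> reaches \<open>n0\<close>.\<close>

lemma density_upper_tail:
  assumes "\<epsilon> > 0"
  shows "\<exists>c n0. 0 < c \<and> (\<forall>n\<ge>n0. \<forall>p0 \<pi>.
      measure_pmf.prob (fsc_law W p0 \<pi> n) {h. real n * (g + 2 * \<epsilon>) < density_score W q h} \<le> exp (- c * real n))"
proof -
  obtain c :: real where c: "c > 0"
    "\<forall>p0 \<pi> n. (\<forall>h. E (\<pi> h) (\<lambda>x. E (W x (cur_state h)) (drift (cur_state h) x)) \<le> 0) \<longrightarrow>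
      measure_pmf.prob (fsc_law W p0 \<pi> n) {h. n * \<epsilon> \<le> score drift h} \<le> exp (- c * n)"
    using score_concentration[OF assms, of W drift] by blast
  define n0 where "n0 = nat \<lceil>Max (range f) / \<epsilon>\<rceil>"
  show ?thesis
  proof (intro exI[of _ c] exI[of _ n0] conjI allI impI c(1))
    fix n p0 and \<pi> :: "('x, 'y, 's) traj \<Rightarrow> 'x pmf"
    assume "n0 \<le> n"
    then have n: "Max (range f) \<le> n * \<epsilon>"
      using assms by (simp add: n0_def ceiling_le_iff divide_le_eq nat_le_iff)
    have "E (\<pi> h) (\<lambda>x. E (W x (cur_state h)) (drift (cur_state h) x)) \<le> 0" for h
      using expectation_mono_pmf[of "\<pi> h" "\<lambda>x. E (W x (cur_state h)) (drift (cur_state h) x)" "\<lambda>_. 0"]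
      by (simp add: expectation_drift_le)
    then have "measure_pmf.prob (fsc_law W p0 \<pi> n) {h. n * \<epsilon> \<le> score drift h} \<le> exp (- c * n)"
      using c(2) by blast
    moreover have "measure_pmf.prob (fsc_law W p0 \<pi> n) {h. n * (g + 2 * \<epsilon>) < density_score W q h}
        \<le> measure_pmf.prob (fsc_law W p0 \<pi> n) {h. n * \<epsilon> \<le> score drift h}"
    proof (rule prob_mono_support)
      fix h assume h: "h \<in> set_pmf (fsc_law W p0 \<pi> n)" and "h \<in> {h. n * (g + 2 * \<epsilon>) < density_score W q h}"
      moreover have "n * (g + 2 * \<epsilon>) = n * g + 2 * (n * \<epsilon>)"
        by (simp add: algebra_simps)
      ultimately show "h \<in> {h. n * \<epsilon> \<le> score drift h}"
        using score_drift[OF h] n by (simp only: mem_Collect_eq abs_le_iff) linarith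
    qed
    ultimately show "measure_pmf.prob (fsc_law W p0 \<pi> n) {h. n * (g + 2 * \<epsilon>) < density_score W q h}
        \<le> exp (- c * n)" by linarith
  qed
qed

text \<open>Under \<open>q\<close> the drift has mean exactly 0, so its negative meets the
  hypothesis of the concentration bound too.\<close>

lemma density_lower_tail:
  assumes "\<epsilon> > 0"
  shows "\<exists>c n0. 0 < c \<and> (\<forall>n\<ge>n0. \<forall>p0. measure_pmf.prob (fsc_law W p0 (markov_rule (\<lambda>_. q)) n)
      {h. density_score W q h \<le> real n * (g - 2 * \<epsilon>)} \<le> exp (- c * real n))"
proof -
  let ?neg = "\<lambda>s x a. - drift s x a"
  obtain c :: real where c: "c > 0"
    "\<forall>p0 \<pi> n. (\<forall>h. E (\<pi> h) (\<lambda>x. E (W x (cur_state h)) (?neg (cur_state h) x)) \<le> 0) \<longrightarrow>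
      measure_pmf.prob (fsc_law W p0 \<pi> n) {h. n * \<epsilon> \<le> score ?neg h} \<le> exp (- c * n)"
    using score_concentration[OF assms, of W ?neg] by blast
  define n0 where "n0 = nat \<lceil>Max (range f) / \<epsilon>\<rceil>"
  show ?thesis
  proof (intro exI[of _ c] exI[of _ n0] conjI allI impI c(1))
    fix n p0
    let ?P = "fsc_law W p0 (markov_rule (\<lambda>_. q)) n"
    assume "n0 \<le> n"
    then have n: "Max (range f) \<le> n * \<epsilon>"
      using assms by (simp add: n0_def ceiling_le_iff divide_le_eq nat_le_iff)
    have "E (markov_rule (\<lambda>_. q) h) (\<lambda>x. E (W x (cur_state h)) (?neg (cur_state h) x)) \<le> 0"
      for h :: "('x, 'y, 's) traj"
      using expectation_drift_q[of "cur_state h"] by (simp add: markov_rule_def)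
    then have "measure_pmf.prob ?P {h. n * \<epsilon> \<le> score ?neg h} \<le> exp (- c * n)"
      using c(2) by blast
    moreover have "measure_pmf.prob ?P {h. density_score W q h \<le> n * (g - 2 * \<epsilon>)}
        \<le> measure_pmf.prob ?P {h. n * \<epsilon> \<le> score ?neg h}"
    proof (rule prob_mono_support)
      fix h assume h: "h \<in> set_pmf ?P" and "h \<in> {h. density_score W q h \<le> n * (g - 2 * \<epsilon>)}"
      moreover have "n * (g - 2 * \<epsilon>) = n * g - 2 * (n * \<epsilon>)"
        by (simp add: algebra_simps)
      ultimately show "h \<in> {h. n * \<epsilon> \<le> score ?neg h}"
        using score_drift[OF h] n
        by (simp only: mem_Collect_eq abs_le_iff score_uminus) linarith
    qed
    ultimately show "measure_pmf.prob ?P {h. density_score W q h \<le> n * (g - 2 * \<epsilon>)} \<le> exp (- c * n)"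
      by linarith
  qed
qed

text \<open>Off the tail event the true law is at most \<open>2 powr t\<close> times that of the
  reference channel. There the observations are independent of the message, so the disjoint decoding
  sets share total probability at most 1; averaging over messages gives the bound.\<close>

lemma success_bound:
  assumes "M > 0" and "2 powr (N * R) \<le> real M"
    and tail: "\<And>p0 \<pi>. measure_pmf.prob (fsc_law W p0 \<pi> N) {h. t < density_score W q h} \<le> \<delta>"
    and err: "\<And>m. m < M \<Longrightarrow> error_prob W N e d s0 m \<le> \<epsilon>"
  shows "1 - \<epsilon> \<le> \<delta> + 2 powr (t - N * R)"
proof -
  define \<pi> where "\<pi> m h = return_pmf (e m (traj_states h) (traj_outputs h))" for m and h :: "('x, 'y, 's) traj"
  define P where "P m = fsc_law W (return_pmf s0) (\<pi> m) N" for m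
  define Qo where "Qo = map_pmf observation (fsc_law (output_kernel W q) (return_pmf s0) (\<pi> 0) N)"
  define D where "D m = {ob. d (fst ob) (snd ob) = m}" for m
  have "1 - \<epsilon> \<le> \<delta> + 2 powr t * measure_pmf.prob Qo (D m)" if "m < M" for m
  proof -
    \<comment> \<open>The reference channel produces the same observation law for message
      \<open>m\<close> as for message 0, which \<open>Qo\<close> fixes.\<close>
    have Qo: "Qo = map_pmf observation (fsc_law (output_kernel W q) (return_pmf s0) (\<pi> m) N)"
      unfolding Qo_def
      by (rule observation_law_eq[where r = "\<lambda>s. output_pmf W (q s) s"]) (simp_all add: output_kernel_def)
    have obs: "observation -` D m = {h. d (traj_states h) (traj_outputs h) = m}"
      by (auto simp: D_def observation_def)
    have "1 - \<epsilon> \<le> 1 - error_prob W N e d s0 m"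
      using err[OF that] by simp
    also have "\<dots> = measure_pmf.prob (P m) (observation -` D m)"
      unfolding error_prob_def P_def \<pi>_def[abs_def] obs
      by (subst measure_pmf.prob_compl[symmetric]) (auto intro!: arg_cong2[where f = measure])
    also have "\<dots> \<le> measure_pmf.prob (P m) ({h. t < density_score W q h} \<union>
        (observation -` D m \<inter> {h. density_score W q h \<le> t}))"
      by (intro measure_pmf.finite_measure_mono) auto
    also have "\<dots> \<le> measure_pmf.prob (P m) {h. t < density_score W q h} +
        measure_pmf.prob (P m) (observation -` D m \<inter> {h. density_score W q h \<le> t})"
      by (intro measure_Un_le) auto
    also have "\<dots> \<le> \<delta> + 2 powr t * measure_pmf.prob (fsc_law (output_kernel W q) (return_pmf s0) (\<pi> m) N)
        (observation -` D m \<inter> {h. density_score W q h \<le> t})"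
      unfolding P_def by (intro add_mono tail prob_le_output_prob output_pos) auto
    also have "\<dots> \<le> \<delta> + 2 powr t * measure_pmf.prob (fsc_law (output_kernel W q) (return_pmf s0) (\<pi> m) N)
        (observation -` D m)"
      by (intro add_left_mono mult_left_mono measure_pmf.finite_measure_mono) auto
    also have "\<dots> = \<delta> + 2 powr t * measure_pmf.prob Qo (D m)"
      by (simp add: Qo)
    finally show ?thesis .
  qed
  then have "(\<Sum>m<M. 1 - \<epsilon>) \<le> (\<Sum>m<M. \<delta> + 2 powr t * measure_pmf.prob Qo (D m))"
    by (intro sum_mono) auto
  then have "M * (1 - \<epsilon>) \<le> M * \<delta> + 2 powr t * (\<Sum>m<M. measure_pmf.prob Qo (D m))"
    by (simp add: sum.distrib sum_distrib_left)
  also have "(\<Sum>m<M. measure_pmf.prob Qo (D m)) = measure_pmf.prob Qo (\<Union>m<M. D m)"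
    by (rule measure_pmf.finite_measure_finite_Union[symmetric]) (auto simp: D_def disjoint_family_on_def)
  also have "M * \<delta> + 2 powr t * \<dots> \<le> M * \<delta> + 2 powr t * 1"
    by (intro add_left_mono mult_left_mono) auto
  also have "2 powr t * 1 = 2 powr (N * R) * 2 powr (t - N * R)"
    by (simp add: powr_add[symmetric])
  also have "M * \<delta> + \<dots> \<le> M * \<delta> + M * 2 powr (t - N * R)"
    by (intro add_left_mono mult_right_mono assms(2)) auto
  finally have "M * (1 - \<epsilon>) \<le> M * (\<delta> + 2 powr (t - N * R))"
    by (simp add: algebra_simps)
  then show ?thesis using assms(1) by simp
qed

lemma feedback_rate_le:
  assumes "achievable_feedback W R"
  shows "R \<le> g"
proof (rule ccontr)
  assume "\<not> R \<le> g"
  \<comment> \<open>A third of the gap leaves a margin \<epsilon> between the rate and the density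
    threshold \<open>g + 2 * \<epsilon>\<close>.\<close>
  define \<epsilon> where "\<epsilon> = (R - g) / 3"
  have \<epsilon>: "\<epsilon> > 0" "R = g + 3 * \<epsilon>" using \<open>\<not> R \<le> g\<close> by (auto simp: \<epsilon>_def field_simps)
  obtain c :: real and n0 where c: "c > 0"
    "\<forall>n\<ge>n0. \<forall>p0 \<pi>.
      measure_pmf.prob (fsc_law W p0 \<pi> n) {h. real n * (g + 2 * \<epsilon>) < density_score W q h} \<le> exp (- c * real n)"
    using density_upper_tail[OF \<epsilon>(1)] by blast
  \<comment> \<open>\<open>undefined\<close> stands for one fixed initial state.\<close>
  obtain e d where lim: "(\<lambda>N. max_error_prob W R N (e N) (d N) undefined) \<longlonglongrightarrow> 0"
    using assms unfolding achievable_feedback_def by blast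
  have "1 - max_error_prob W R N (e N) (d N) undefined \<le> exp (- c * N) + exp (- (\<epsilon> * ln 2) * N)"
    if "n0 \<le> N" for N
  proof -
    have "1 - max_error_prob W R N (e N) (d N) undefined \<le> exp (- c * N) + 2 powr (N * (g + 2 * \<epsilon>) - N * R)"
    proof (rule success_bound[OF num_messages_pos num_messages_ge])
      show "measure_pmf.prob (fsc_law W p0 \<pi> N) {h. N * (g + 2 * \<epsilon>) < density_score W q h} \<le> exp (- c * N)"
        for p0 \<pi> using c(2) that by blast
      show "error_prob W N (e N) (d N) undefined m \<le> max_error_prob W R N (e N) (d N) undefined"
        if "m < num_messages N R" for m
        using that unfolding max_error_prob_def by (intro Max_ge) auto
    qed
    also have "N * (g + 2 * \<epsilon>) - N * R = - \<epsilon> * N"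
      by (simp add: \<epsilon>(2) algebra_simps)
    finally show ?thesis by (simp add: powr_def mult_ac)
  qed
  then have "\<forall>\<^sub>F N in sequentially.
      1 - max_error_prob W R N (e N) (d N) undefined \<le> exp (- c * N) + exp (- (\<epsilon> * ln 2) * N)"
    by (intro eventually_sequentiallyI)
  moreover have "(\<lambda>N. 1 - max_error_prob W R N (e N) (d N) undefined) \<longlonglongrightarrow> 1 - 0"
    by (intro tendsto_intros lim)
  moreover have "(\<lambda>N. exp (- c * real N) + exp (- (\<epsilon> * ln 2) * real N)) \<longlonglongrightarrow> 0 + 0"
    using c(1) \<epsilon>(1) by (intro tendsto_add exp_linear_tendsto_0) auto
  ultimately have "1 - 0 \<le> (0 + 0 :: real)"
    by (intro tendsto_le[of sequentially]) auto
  then show False by simp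
qed

end

subsection \<open>Achievability\<close>

lemma exists_ge_expectation:
  assumes "finite (set_pmf U)" and "c \<le> E U F"
  shows "\<exists>u. c \<le> F u"
proof (rule ccontr)
  assume "\<not> ?thesis"
  then have less: "F u < c" for u by (simp add: not_le)
  define m where "m = Max (F ` set_pmf U)"
  have "m \<in> F ` set_pmf U"
    unfolding m_def using assms(1) set_pmf_not_empty by (intro Max_in) auto
  then have "m < c" using less by auto
  moreover have "E U F \<le> E U (\<lambda>_. m)"
    using assms(1) by (intro expectation_mono_pmf) (auto simp: m_def)
  ultimately show False using assms(2) by simp
qed

text \<open>
  Feinstein's greedy construction: as long as fewer than \<open>M\<close> messages are placed, the decoding sets
  used so far have output probability at most \<open>M * \<delta>\<close>, so an average strategy still has enough
  probability outside them.
\<close>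
lemma feinstein:
  fixes M :: nat and \<alpha> \<delta> :: real
  assumes fin: "finite (set_pmf U)" "\<And>u. finite (set_pmf (P u))"
    and mixture: "Q = bind_pmf U P"
    and small: "\<And>u. measure_pmf.prob Q (A u) \<le> \<delta>"
    and typical: "1 - \<alpha> \<le> E U (\<lambda>u. measure_pmf.prob (P u) (A u))"
  shows "\<exists>u D. (\<forall>m<M. 1 - (\<alpha> + M * \<delta>) \<le> measure_pmf.prob (P (u m)) (D m)) \<and>
    (\<forall>m<M. \<forall>m'<M. m \<noteq> m' \<longrightarrow> D m \<inter> D m' = {})"
proof -
  have "0 \<le> \<delta>" using small[of undefined] measure_nonneg order_trans by blast
  \<comment> \<open>The induction also carries \<open>D m \<subseteq> A (u m)\<close>, which bounds
    the mixture probability of each placed set by \<delta>.\<close>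
  have "\<exists>u D. (\<forall>m<k. D m \<subseteq> A (u m) \<and> 1 - (\<alpha> + M * \<delta>) \<le> measure_pmf.prob (P (u m)) (D m)) \<and>
      (\<forall>m<k. \<forall>m'<k. m \<noteq> m' \<longrightarrow> D m \<inter> D m' = {})" if "k \<le> M" for k
    using that
  proof (induction k)
    case 0
    show ?case by simp
  next
    case (Suc k)
    have "k \<le> M" using Suc.prems by simp
    from Suc.IH[OF this] obtain u D where uD:
      "\<forall>m<k. D m \<subseteq> A (u m) \<and> 1 - (\<alpha> + M * \<delta>) \<le> measure_pmf.prob (P (u m)) (D m)"
      and disj: "\<forall>m<k. \<forall>m'<k. m \<noteq> m' \<longrightarrow> D m \<inter> D m' = {}"
      by blast
    define B where "B = (\<Union>m<k. D m)"
    have "measure_pmf.prob Q B \<le> (\<Sum>m<k. measure_pmf.prob Q (D m))"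
      unfolding B_def by (rule measure_pmf.finite_measure_subadditive_finite) auto
    also have "\<dots> \<le> (\<Sum>m<k. \<delta>)"
    proof (rule sum_mono)
      fix m assume "m \<in> {..<k}"
      then have "measure_pmf.prob Q (D m) \<le> measure_pmf.prob Q (A (u m))"
        using uD by (intro measure_pmf.finite_measure_mono) auto
      then show "measure_pmf.prob Q (D m) \<le> \<delta>" using small order_trans by blast
    qed
    also have "\<dots> \<le> M * \<delta>" using Suc.prems \<open>0 \<le> \<delta>\<close> by (simp add: mult_right_mono)
    finally have QB: "measure_pmf.prob Q B \<le> M * \<delta>" .
    have "measure_pmf.prob Q B = E (bind_pmf U P) (indicator B)"
      by (simp add: mixture)
    also have "\<dots> = E U (\<lambda>u. measure_pmf.prob (P u) B)"
      using fin by (subst expectation_bind_pmf) auto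
    finally have QB_eq: "measure_pmf.prob Q B = E U (\<lambda>u. measure_pmf.prob (P u) B)" .
    have "1 - (\<alpha> + M * \<delta>) \<le>
        E U (\<lambda>u. measure_pmf.prob (P u) (A u)) - E U (\<lambda>u. measure_pmf.prob (P u) B)"
      using typical QB QB_eq by linarith
    also have "\<dots> = E U (\<lambda>u. measure_pmf.prob (P u) (A u) - measure_pmf.prob (P u) B)"
      using fin(1) by (simp add: integrable_measure_pmf_finite)
    finally obtain v where v: "1 - (\<alpha> + M * \<delta>) \<le> measure_pmf.prob (P v) (A v) - measure_pmf.prob (P v) B"
      using exists_ge_expectation[OF fin(1)] by blast
    have "measure_pmf.prob (P v) (A v) \<le> measure_pmf.prob (P v) ((A v - B) \<union> B)"
      by (intro measure_pmf.finite_measure_mono) auto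
    also have "\<dots> \<le> measure_pmf.prob (P v) (A v - B) + measure_pmf.prob (P v) B"
      by (intro measure_Un_le) auto
    finally have v': "1 - (\<alpha> + M * \<delta>) \<le> measure_pmf.prob (P v) (A v - B)"
      using v by linarith
    have "D m \<inter> (A v - B) = {}" if "m < k" for m
      using that by (auto simp: B_def)
    then show ?case
      using uD disj v' by (intro exI[of _ "u(k := v)"] exI[of _ "D(k := A v - B)"]) (auto simp: less_Suc_eq)
  qed
  from this[of M] show ?thesis by blast
qed

context average_reward_solution
begin

text \<open>Feinstein's construction, applied to the mixture of deterministic strategies that
  realizes \<open>q\<close>; decoding sets consist of observations whose rebuilt trajectory has
  density above \<open>t\<close>.\<close>

lemma strategy_code:
  fixes s0 :: 's and n M :: nat and t :: real
  defines "\<epsilon> \<equiv> measure_pmf.prob (fsc_law W (return_pmf s0) (markov_rule (\<lambda>_. q)) n)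
      {h. density_score W q h \<le> t} + M * 2 powr (- t)"
  shows "\<exists>u D. (\<forall>m<M. 1 - \<epsilon> \<le> measure_pmf.prob
        (fsc_law W (return_pmf s0) (state_policy (u m)) n) {h. observation h \<in> D m}) \<and>
      (\<forall>m<M. \<forall>m'<M. m \<noteq> m' \<longrightarrow> D m \<inter> D m' = {})"
proof -
  let ?law = "\<lambda>\<pi>. fsc_law W (return_pmf s0) \<pi> n"
  let ?mix = "?law (markov_rule (\<lambda>_. q))"
  obtain U where U: "finite (set_pmf U)" "?mix = bind_pmf U (\<lambda>u. ?law (state_policy u))"
    using markov_rule_mixture by blast
  define P where "P u = map_pmf observation (?law (state_policy u))" for u
  define A where "A u = {ob. rebuild u ob \<in> set_pmf (?law (state_policy u)) \<and>
      t < density_score W q (rebuild u ob)}" for u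
  have mixture: "map_pmf observation ?mix = bind_pmf U P"
    by (simp add: U(2) map_bind_pmf P_def[abs_def])
  have small: "measure_pmf.prob (map_pmf observation ?mix) (A u) \<le> 2 powr (- t)" for u
  proof -
    let ?R = "fsc_law (output_kernel W q) (return_pmf s0) (state_policy u) n"
    \<comment> \<open>The mixture and the reference channel have the same observation law, so the
      probability can be computed under strategy \<open>u\<close> on the reference channel, where
      the change of measure applies.\<close>
    have "map_pmf observation ?mix = map_pmf observation ?R"
      by (rule observation_law_eq[where r = "\<lambda>s. output_pmf W (q s) s"])
        (simp_all add: output_kernel_def markov_rule_def output_pmf_def)
    then have "measure_pmf.prob (map_pmf observation ?mix) (A u) = measure_pmf.prob ?R (observation -` A u)"
      by simp
    also have "\<dots> \<le> measure_pmf.prob ?R {h \<in> set_pmf (?law (state_policy u)). t < density_score W q h}"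
      by (rule prob_mono_support) (auto simp: A_def rebuild_observation)
    also have "\<dots> \<le> 2 powr (- t)"
      by (rule output_prob_le[OF output_pos]) auto
    finally show ?thesis .
  qed
  have "1 - measure_pmf.prob ?mix {h. density_score W q h \<le> t} = measure_pmf.prob ?mix {h. t < density_score W q h}"
    by (subst measure_pmf.prob_compl[symmetric]) (auto intro!: arg_cong2[where f = measure])
  also have "\<dots> = E ?mix (indicator {h. t < density_score W q h})"
    by simp
  also have "\<dots> = E U (\<lambda>u. measure_pmf.prob (?law (state_policy u)) {h. t < density_score W q h})"
    unfolding U(2) using U(1) by (subst expectation_bind_pmf) auto
  also have "\<dots> \<le> E U (\<lambda>u. measure_pmf.prob (P u) (A u))"
  proof (rule expectation_mono_pmf[OF U(1)])
    fix u
    have "measure_pmf.prob (?law (state_policy u)) {h. t < density_score W q h}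
        \<le> measure_pmf.prob (?law (state_policy u)) (observation -` A u)"
      by (rule prob_mono_support) (auto simp: A_def rebuild_observation)
    then show "measure_pmf.prob (?law (state_policy u)) {h. t < density_score W q h} \<le> measure_pmf.prob (P u) (A u)"
      by (simp add: P_def)
  qed
  finally have typical: "1 - measure_pmf.prob ?mix {h. density_score W q h \<le> t} \<le>
      E U (\<lambda>u. measure_pmf.prob (P u) (A u))" .
  have "finite (set_pmf (P u))" for u by (simp add: P_def)
  from feinstein[OF U(1) this mixture small typical, of M]
  show ?thesis by (simp add: \<epsilon>_def P_def vimage_def)
qed

lemma achievable_less:
  assumes "0 \<le> R" "R < g"
  shows "achievable W R"
proof -
  \<comment> \<open>The threshold \<open>g - 2 * \<epsilon>\<close> equals
    \<open>R + \<epsilon>\<close>, so the term counting messages decays exponentially along with the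
    tail.\<close>
  define \<epsilon> where "\<epsilon> = (g - R) / 3"
  have \<epsilon>: "\<epsilon> > 0" "g = R + 3 * \<epsilon>" using assms(2) by (auto simp: \<epsilon>_def field_simps)
  define t where "t N = real N * (g - 2 * \<epsilon>)" for N
  obtain c :: real and n0 where c: "c > 0"
    "\<forall>n\<ge>n0. \<forall>p0. measure_pmf.prob (fsc_law W p0 (markov_rule (\<lambda>_. q)) n)
      {h. density_score W q h \<le> real n * (g - 2 * \<epsilon>)} \<le> exp (- c * real n)"
    using density_lower_tail[OF \<epsilon>(1)] by blast
  define \<eta> where "\<eta> s0 N = measure_pmf.prob (fsc_law W (return_pmf s0) (markov_rule (\<lambda>_. q)) N)
      {h. density_score W q h \<le> t N} + num_messages N R * 2 powr (- t N)" for s0 N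
  define good where "good s0 N u D \<longleftrightarrow> (\<forall>m<num_messages N R. 1 - \<eta> s0 N \<le> measure_pmf.prob
        (fsc_law W (return_pmf s0) (state_policy (u m)) N) {h. observation h \<in> D m}) \<and>
      (\<forall>m<num_messages N R. \<forall>m'<num_messages N R. m \<noteq> m' \<longrightarrow> D m \<inter> D m' = {})"
    for s0 N u and D :: "nat \<Rightarrow> ('s list \<times> 'y list) set"
  have "\<exists>u D. good s0 N u D" for s0 N
    using strategy_code[where t = "t N" and M = "num_messages N R"] unfolding \<eta>_def good_def .
  then obtain u D where good: "\<And>s0 N. good s0 N (u s0 N) (D s0 N)"
    by metis
  note code = good[unfolded good_def, THEN conjunct1, rule_format]
    and disj = good[unfolded good_def, THEN conjunct2, rule_format]
  \<comment> \<open>Encoder and decoder both read \<open>s0\<close> off the head of the state list,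
    so the codes built for each initial state combine into one.\<close>
  define e where "e N m ss = u (hd ss) N m ss" for N m ss
  define d where "d N ss ys = (THE m. m < num_messages N R \<and> (ss, ys) \<in> D (hd ss) N m)" for N ss ys
  have error: "error_prob W N (\<lambda>m ss ys. e N m ss) (d N) s0 m \<le> \<eta> s0 N" if m: "m < num_messages N R" for N s0 m
  proof -
    let ?P = "fsc_law W (return_pmf s0) (state_policy (u s0 N m)) N"
    have hd: "hd (traj_states h) = fst h" for h :: "('x, 'y, 's) traj"
      by (simp add: traj_states_def)
    have law: "?P = fsc_law W (return_pmf s0) (\<lambda>h. return_pmf (e N m (traj_states h))) N"
      by (rule fsc_law_cong) (auto simp: state_policy_def e_def hd dest: fst_fsc_law)
    have "error_prob W N (\<lambda>m ss ys. e N m ss) (d N) s0 m \<le> measure_pmf.prob ?P {h. observation h \<notin> D s0 N m}"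
      unfolding error_prob_def law
    proof (rule prob_mono_support)
      fix h assume h: "h \<in> set_pmf (fsc_law W (return_pmf s0) (\<lambda>h. return_pmf (e N m (traj_states h))) N)"
        "h \<in> {h. d N (traj_states h) (traj_outputs h) \<noteq> m}"
      have "fst h = s0" using fst_fsc_law[OF h(1)] by simp
      show "h \<in> {h. observation h \<notin> D s0 N m}"
      proof (rule ccontr)
        assume "h \<notin> {h. observation h \<notin> D s0 N m}"
        then have mem: "(traj_states h, traj_outputs h) \<in> D (hd (traj_states h)) N m"
          using \<open>fst h = s0\<close> by (simp add: observation_def hd)
        have "d N (traj_states h) (traj_outputs h) = m"
          unfolding d_def
        proof (rule the_equality)
          show "m < num_messages N R \<and> (traj_states h, traj_outputs h) \<in> D (hd (traj_states h)) N m"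
            using m mem by simp
          show "m' = m" if "m' < num_messages N R \<and> (traj_states h, traj_outputs h) \<in> D (hd (traj_states h)) N m'" for m'
            using disj[of m' N m] m mem that by blast
        qed
        then show False using h(2) by simp
      qed
    qed
    also have "\<dots> = 1 - measure_pmf.prob ?P {h. observation h \<in> D s0 N m}"
      by (subst measure_pmf.prob_compl[symmetric]) (auto intro!: arg_cong2[where f = measure])
    also have "\<dots> \<le> \<eta> s0 N" using code[OF m, of s0] by simp
    finally show ?thesis .
  qed
  have "(\<lambda>N. max_error_prob W R N (\<lambda>m ss ys. e N m ss) (d N) s0) \<longlonglongrightarrow> 0" for s0
  proof (rule tendsto_sandwich)
    have \<eta>_le: "\<eta> s0 N \<le> exp (- c * real N) + 2 * exp (- (\<epsilon> * ln 2) * real N)" if "n0 \<le> N" for N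
    proof -
      have "num_messages N R * 2 powr (- t N) \<le> 2 * 2 powr (N * R) * 2 powr (- t N)"
        by (intro mult_right_mono num_messages_le assms(1)) auto
      also have "\<dots> = 2 * 2 powr (N * R - t N)"
        by (simp add: powr_add[symmetric])
      also have "N * R - t N = - \<epsilon> * N"
        by (simp add: t_def \<epsilon>(2) algebra_simps)
      finally have "num_messages N R * 2 powr (- t N) \<le> 2 * exp (- (\<epsilon> * ln 2) * real N)"
        by (simp add: powr_def mult_ac)
      then show ?thesis
        using c(2) that unfolding \<eta>_def t_def by (meson add_mono)
    qed
    show "\<forall>\<^sub>F N in sequentially. max_error_prob W R N (\<lambda>m ss ys. e N m ss) (d N) s0
        \<le> exp (- c * real N) + 2 * exp (- (\<epsilon> * ln 2) * real N)"
    proof (intro eventually_sequentiallyI[of n0])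
      fix N assume "n0 \<le> N"
      have "max_error_prob W R N (\<lambda>m ss ys. e N m ss) (d N) s0 \<le> \<eta> s0 N"
        unfolding max_error_prob_def using error num_messages_pos[of N R] by (subst Max_le_iff) auto
      then show "max_error_prob W R N (\<lambda>m ss ys. e N m ss) (d N) s0
        \<le> exp (- c * real N) + 2 * exp (- (\<epsilon> * ln 2) * real N)"
        using \<eta>_le[OF \<open>n0 \<le> N\<close>] by linarith
    qed
    have "0 \<le> max_error_prob W R N (\<lambda>m ss ys. e N m ss) (d N) s0" for N
    proof -
      have "0 \<le> error_prob W N (\<lambda>m ss ys. e N m ss) (d N) s0 0" by (simp add: error_prob_def)
      also have "\<dots> \<le> max_error_prob W R N (\<lambda>m ss ys. e N m ss) (d N) s0"
        unfolding max_error_prob_def using num_messages_pos[of N R] by (intro Max_ge) auto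
      finally show ?thesis .
    qed
    then show "\<forall>\<^sub>F N in sequentially. 0 \<le> max_error_prob W R N (\<lambda>m ss ys. e N m ss) (d N) s0"
      by simp
    have "(\<lambda>N. exp (- c * real N) + 2 * exp (- (\<epsilon> * ln 2) * real N)) \<longlonglongrightarrow> 0 + 2 * 0"
      using c(1) \<epsilon>(1) by (intro tendsto_add tendsto_mult tendsto_const exp_linear_tendsto_0) auto
    then show "(\<lambda>N. exp (- c * real N) + 2 * exp (- (\<epsilon> * ln 2) * real N)) \<longlonglongrightarrow> 0" by simp
  qed simp
  then show ?thesis unfolding achievable_def by blast
qed

end

section \<open>Identification of both capacities\<close>

lemma achievable_0: "achievable W 0"
proof -
  have M: "num_messages N 0 = 1" for N by (simp add: num_messages_def)
  have "max_error_prob W 0 N (\<lambda>m ss ys. undefined) (\<lambda>ss ys. 0) s0 = 0" for N s0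
    by (simp add: max_error_prob_def M error_prob_def lessThan_Suc)
  then show ?thesis
    unfolding achievable_def by (intro exI[of _ "\<lambda>_ _ _. undefined"] exI[of _ "\<lambda>_ _ _. 0"]) simp
qed

lemma achievable_imp_feedback:
  assumes "achievable W R"
  shows "achievable_feedback W R"
proof -
  obtain e d where "\<forall>s0. (\<lambda>N. max_error_prob W R N (\<lambda>m ss ys. e N m ss) (d N) s0) \<longlonglongrightarrow> 0"
    using assms unfolding achievable_def by blast
  then show ?thesis
    unfolding achievable_feedback_def by (intro exI[of _ "\<lambda>N m ss ys. e N m ss"] exI[of _ d])
qed

text \<open>The chain \<open>g \<le> capacity W \<le> capacity_feedback W \<le> g\<close> closes.
  Rate 0 makes \<open>capacity W\<close> at least 0, so a rate strictly between it and
  \<open>g\<close> would be nonnegative and thus achievable.\<close>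

lemma (in average_reward_solution) capacity_eq:
  assumes "0 \<le> g"
  shows "capacity W = ereal g" and "capacity_feedback W = ereal g"
proof -
  have "capacity W \<le> capacity_feedback W"
    unfolding capacity_def capacity_feedback_def
    by (rule SUP_subset_mono) (auto intro: achievable_imp_feedback)
  moreover have "capacity_feedback W \<le> ereal g"
    unfolding capacity_feedback_def by (rule SUP_least) (auto intro: feedback_rate_le)
  moreover have "ereal g \<le> capacity W"
  proof (rule ccontr)
    have ge: "ereal R \<le> capacity W" if "0 \<le> R" "achievable W R" for R
      unfolding capacity_def using that by (intro SUP_upper) auto
    assume "\<not> ereal g \<le> capacity W"
    then obtain R where R: "capacity W < ereal R" "ereal R < ereal g"
      using ereal_dense2[of "capacity W" "ereal g"] by (auto simp: not_le)
    have "ereal 0 < ereal R" using ge[OF order_refl achievable_0] R(1) by (rule le_less_trans)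
    then have "ereal R \<le> capacity W" using R(2) by (intro ge achievable_less) auto
    then show False using R(1) by simp
  qed
  ultimately show "capacity W = ereal g" "capacity_feedback W = ereal g" by auto
qed

theorem theorem18:
  fixes W :: "('x::finite, 'y::finite, 's::finite) kernel"
    and p0 :: "'s pmf"
  assumes "strongly_connected_fsc W"
  shows "capacity_feedback W = capacity W \<and>
    (\<forall>N. \<exists>Q. \<forall>Q'. block_information W p0 N Q' \<le> block_information W p0 N Q) \<and>
    (\<exists>C::real. capacity W = ereal C \<and>
      (\<lambda>N. 1 / real N * (SUP Q. block_information W p0 N Q)) \<longlonglongrightarrow> C)"
proof -
  obtain g f where gf: "0 \<le> g" "\<And>s. 0 \<le> f s" "\<And>s. bellman W f s = g + f s"
    using average_reward_optimality[OF assms] by metis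
  interpret average_reward_solution W g f "greedy W f"
    using gf reward_le_bellman[of W f] by unfold_locales (auto simp: bellman_def)
  show ?thesis
    using capacity_eq[OF gf(1)] block_information_attains_max[of W p0]
      max_block_information_rate[OF gf(2,3), of p0] by auto
qed

end
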